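(* Let $m\in\mathbb N$, let $\{T_{n1},T_{n2}:n\in\{1,\dots,m\}\}$ be a family of pairwise disjoint trees in the open square $(-1,1)^2$, let $T_{01}$ be an arc in $(-1,1)\times\{1\}$ and $T_{02}$ an arc in $(-1,1)\times\{-1\}$. Let $\{W_n:n\in\{0,1,\dots,m\}\}$ be a family of pairwise disjoint countable sets in $(-1,1)^2-\bigcup\{T_{n1}\cup T_{n2}:1\le n\le m\}$, each $W_n$ dense in $[-1,1]^2$. Then there exists a homeomorphism $\psi:[-1,1]^2\to[-1,1]^2$ such that for every $n\in\{0,1,\dots,m\}$ and every $w\in W_n$, $\omega_\psi(w)=T_{n1}$ and $\alpha_\psi(w)=T_{n2}$.
   Context: A tree is a continuum which is a union of finitely many arcs, any two of which are disjoint or meet only in one or both endpoints, and which contains no circle. $\omega_\psi(w)$ is the $\omega$-limit set of $w$ under $\psi$ and $\alpha_\psi(w)=\omega_{\psi^{-1}}(w)$. *)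

theory Defs
  imports "HOL-Analysis.Analysis"
begin

type_synonym pt = "real \<times> real"

definition is_arc :: "pt set \<Rightarrow> bool" where
  "is_arc S \<longleftrightarrow> (\<exists>g. arc g \<and> path_image g = S)"

definition is_circle :: "pt set \<Rightarrow> bool" where
  "is_circle C \<longleftrightarrow> C homeomorphic (sphere (0::pt) 1)"

definition continuum :: "pt set \<Rightarrow> bool" where
  "continuum T \<longleftrightarrow> T \<noteq> {} \<and> compact T \<and> connected T"

definition is_tree :: "pt set \<Rightarrow> bool" where
  "is_tree T \<longleftrightarrow> continuum T \<and>
     (\<exists>F :: (real \<Rightarrow> pt) set. finite F \<and> (\<forall>g\<in>F. arc g) \<and>
        T = (\<Union>g\<in>F. path_image g) \<and>
        (\<forall>g\<in>F. \<forall>h\<in>F. path_image g \<noteq> path_image h \<longrightarrow>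
            path_image g \<inter> path_image h \<subseteq>
              {pathstart g, pathfinish g} \<inter> {pathstart h, pathfinish h})) \<and>
     \<not> (\<exists>C\<subseteq>T. is_circle C)"

definition omega_limit :: "(pt \<Rightarrow> pt) \<Rightarrow> pt \<Rightarrow> pt set" where
  "omega_limit f w = (\<Inter>N. closure {(f ^^ n) w | n. n \<ge> N})"

end

theory Submission
  imports Defs
begin

text \<open>Let \<open>X\<close> be the open square minus the trees. The homeomorphism is a uniform limit of
  homeomorphisms \<open>\<psi>\<^sub>k\<close> of the plane, each the identity near the complement of \<open>X\<close>. At stage \<open>k\<close> only finite
  orbit segments of the points \<open>w\<^sub>0, \<dots>, w\<^sub>k\<close> are prescribed. To extend them, one finds pseudo-orbits
  of \<open>\<psi>\<^sub>k\<close> through new points and turns them into orbits of \<open>h \<circ> \<psi>\<^sub>k\<close> for a small \<open>h\<close>. Once the end of a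
  segment is near its tree, its pseudo-orbits stay near the tree, because the neighbourhood of a
  tree minus the tree is connected and \<open>\<psi>\<^sub>k\<close> is almost the identity there; the segment can thus wander
  along the whole tree while approaching it. A new point \<open>w\<^sub>k\<close> can be led to its tree by pseudo-orbits with
  arbitrarily small jumps because all \<open>\<psi>\<^sub>k\<close> preserve area and hence are chain transitive on the
  connected set \<open>X\<close>.\<close>

section \<open>Twist maps preserve area\<close>

text \<open>The map has to be corrected for ever while the orbits approach their trees, yet the
  corrections must add up to a homeomorphism that fixes the trees. Near the complement of
  \<open>X\<close> everything is therefore measured relative to the distance \<open>d\<close> to it:
  for \<open>d x < 3 * \<rho>\<close> the map moves \<open>x\<close> by at most
  \<open>tol k * d x\<close>, and a correction about a hundred times as large is permitted, so that
  pseudo-orbits there may use the identity in place of the map. The next stage needs the smaller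
  factor \<open>tol (Suc k)\<close> only in a thinner collar, where the present map is already the
  identity and the correction is kept tiny. A correction carries finitely many points to prescribed
  ones, so all orbit points must be distinct and must miss the countably many starting points still
  to come. It must preserve area, or the chain argument would fail at the next stage; twists about a
  centre provide this. The sets \<open>W n\<close> are merged into one sequence \<open>w\<close>,
  each term with its own two targets. Boundary arcs are handled like trees: what counts is a compact
  set outside \<open>X\<close>, in its closure, with connected thin collars.\<close>

definition rot :: "real \<Rightarrow> real \<times> real \<Rightarrow> real \<times> real" where
  "rot t z = (fst z * cos t - snd z * sin t, fst z * sin t + snd z * cos t)"

lemma rot_0 [simp]: "rot 0 z = z"
  by (simp add: rot_def)

lemma rot_rot: "rot s (rot t z) = rot (s + t) z"
  by (simp add: rot_def cos_add sin_add algebra_simps)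

lemma norm_rot [simp]: "norm (rot t z) = norm z"
proof -
  have "(fst z * cos t - snd z * sin t)\<^sup>2 + (fst z * sin t + snd z * cos t)\<^sup>2
      = ((fst z)\<^sup>2 + (snd z)\<^sup>2) * ((sin t)\<^sup>2 + (cos t)\<^sup>2)"
    by algebra
  then show ?thesis by (simp add: rot_def norm_prod_def)
qed

lemma continuous_on_rot:
  fixes f :: "'a::t2_space \<Rightarrow> real"
  assumes "continuous_on S f" "continuous_on S g"
  shows "continuous_on S (\<lambda>x. rot (f x) (g x))"
  unfolding rot_def using assms by (intro continuous_intros)

lemma rot_measurable [measurable]: "rot t \<in> borel_measurable borel"
  by (rule borel_measurable_continuous_onI) (auto intro!: continuous_on_rot continuous_intros)

definition area_preserving :: "(real \<times> real \<Rightarrow> real \<times> real) \<Rightarrow> bool" where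
  "area_preserving f \<longleftrightarrow> f \<in> borel_measurable borel \<and> (\<forall>A\<in>sets borel. emeasure lborel (f -` A) = emeasure lborel A)"

lemma area_preserving_comp:
  assumes "area_preserving f" "area_preserving g" shows "area_preserving (\<lambda>x. f (g x))"
proof -
  have "emeasure lborel ((\<lambda>x. f (g x)) -` A) = emeasure lborel A" if A: "A \<in> sets borel" for A
  proof -
    have "f -` A \<in> sets borel"
      using assms(1) A measurable_sets[of f borel borel A] by (simp add: area_preserving_def)
    moreover have "(\<lambda>x. f (g x)) -` A = g -` (f -` A)" by auto
    ultimately show ?thesis using assms A by (simp add: area_preserving_def)
  qed
  moreover have "(\<lambda>x. f (g x)) \<in> borel_measurable borel"
    using assms by (auto simp: area_preserving_def)
  ultimately show ?thesis by (simp add: area_preserving_def)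
qed

lemma emeasure_lborel_translate:
  fixes c :: "'a::euclidean_space"
  assumes "A \<in> sets borel"
  shows "emeasure lborel ((\<lambda>x. c + x) -` A) = emeasure lborel A"
proof -
  have "emeasure (distr lborel borel ((+) c)) A = emeasure lborel ((\<lambda>x. c + x) -` A)"
    using assms by (subst emeasure_distr) auto
  then show ?thesis by (simp add: lborel_distr_plus)
qed

text \<open>Fubini: on the horizontal line at height \<open>y\<close> the shear is the translation
  by \<open>a * y\<close>, which preserves length.\<close>

lemma area_preserving_shear1: "area_preserving (\<lambda>z. (fst z + a * snd z, snd z))"
proof -
  let ?f = "\<lambda>z::real\<times>real. (fst z + a * snd z, snd z)"
  have m: "?f \<in> borel_measurable borel"
    by (rule borel_measurable_continuous_onI) (intro continuous_intros)
  have "emeasure lborel (?f -` A) = emeasure lborel A" if A: "A \<in> sets borel" for A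
  proof -
    have A': "A \<in> sets ((lborel :: real measure) \<Otimes>\<^sub>M (lborel :: real measure))"
      unfolding lborel_prod using A by simp
    have fA: "?f -` A \<in> sets ((lborel :: real measure) \<Otimes>\<^sub>M (lborel :: real measure))"
      unfolding lborel_prod using A m measurable_sets[of ?f borel borel A] by simp
    have s: "(\<lambda>x. (x, y)) -` A \<in> sets lborel" for y
      using sets_Pair2[OF A'] .
    have "emeasure lborel (?f -` A) = (\<integral>\<^sup>+y. emeasure lborel ((\<lambda>x. (x, y)) -` (?f -` A)) \<partial>lborel)"
      using lborel_pair.emeasure_pair_measure_alt2[OF fA] by (simp add: lborel_prod)
    also have "\<dots> = (\<integral>\<^sup>+y. emeasure lborel ((\<lambda>x. a * y + x) -` ((\<lambda>x. (x, y)) -` A)) \<partial>lborel)"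
      by (simp add: vimage_def algebra_simps)
    also have "\<dots> = (\<integral>\<^sup>+y. emeasure lborel ((\<lambda>x. (x, y)) -` A) \<partial>lborel)"
      using s by (subst emeasure_lborel_translate) auto
    also have "\<dots> = emeasure lborel A"
      using lborel_pair.emeasure_pair_measure_alt2[OF A'] by (simp add: lborel_prod)
    finally show ?thesis .
  qed
  then show ?thesis using m by (simp add: area_preserving_def)
qed

lemma area_preserving_shear2: "area_preserving (\<lambda>z. (fst z, snd z + a * fst z))"
proof -
  let ?f = "\<lambda>z::real\<times>real. (fst z, snd z + a * fst z)"
  have m: "?f \<in> borel_measurable borel"
    by (rule borel_measurable_continuous_onI) (intro continuous_intros)
  have "emeasure lborel (?f -` A) = emeasure lborel A" if A: "A \<in> sets borel" for A
  proof -
    have A': "A \<in> sets ((lborel :: real measure) \<Otimes>\<^sub>M (lborel :: real measure))"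
      unfolding lborel_prod using A by simp
    have fA: "?f -` A \<in> sets ((lborel :: real measure) \<Otimes>\<^sub>M (lborel :: real measure))"
      unfolding lborel_prod using A m measurable_sets[of ?f borel borel A] by simp
    have s: "Pair x -` A \<in> sets lborel" for x
      using sets_Pair1[OF A'] .
    have "emeasure lborel (?f -` A) = (\<integral>\<^sup>+x. emeasure lborel (Pair x -` (?f -` A)) \<partial>lborel)"
      using lborel.emeasure_pair_measure_alt[OF fA] by (simp add: lborel_prod)
    also have "\<dots> = (\<integral>\<^sup>+x. emeasure lborel ((\<lambda>y. a * x + y) -` (Pair x -` A)) \<partial>lborel)"
      by (simp add: vimage_def algebra_simps)
    also have "\<dots> = (\<integral>\<^sup>+x. emeasure lborel (Pair x -` A) \<partial>lborel)"
      using s by (subst emeasure_lborel_translate) auto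
    also have "\<dots> = emeasure lborel A"
      using lborel.emeasure_pair_measure_alt[OF A'] by (simp add: lborel_prod)
    finally show ?thesis .
  qed
  then show ?thesis using m by (simp add: area_preserving_def)
qed

text \<open>A rotation by an angle other than \<open>\<pi>\<close> is a product of three shears.\<close>

lemma area_preserving_rot: "area_preserving (rot t)"
proof -
  have *: "area_preserving (rot t)" if "cos t \<noteq> -1" for t
  proof -
    \<comment> \<open>This is \<open>- tan (t/2)\<close>, the coefficient for which a horizontal
      shear, the vertical shear by \<open>sin t\<close> and the same horizontal shear compose to the
      rotation.\<close>
    define a where "a = - sin t / (1 + cos t)"
    have ne: "1 + cos t \<noteq> 0" using that by linarith
    have s2: "sin t * sin t = (1 + cos t) * (1 - cos t)"
      using sin_cos_squared_add[of t] by (simp add: power2_eq_square algebra_simps)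
    have c: "1 + a * sin t = cos t"
      using ne s2 by (simp add: a_def field_simps)
    have "a * (1 + cos t) = - sin t" using ne by (simp add: a_def)
    then have d: "a + cos t * a = - sin t" by (simp add: algebra_simps)
    define f where "f = (\<lambda>z::real\<times>real. (fst z + a * snd z, snd z))"
    define g where "g = (\<lambda>z::real\<times>real. (fst z, snd z + sin t * fst z))"
    have "rot t z = f (g (f z))" for z
    proof -
      have "fst z + a * snd z + a * (snd z + sin t * (fst z + a * snd z))
          = (1 + a * sin t) * fst z + (a + (1 + a * sin t) * a) * snd z" by algebra
      then have 1: "fst z + a * snd z + a * (snd z + sin t * (fst z + a * snd z)) = fst z * cos t - snd z * sin t"
        by (simp only: c d) simp
      have "snd z + sin t * (fst z + a * snd z) = fst z * sin t + snd z * (1 + a * sin t)"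
        by algebra
      then have 2: "snd z + sin t * (fst z + a * snd z) = fst z * sin t + snd z * cos t"
        by (simp only: c)
      show ?thesis
        unfolding f_def g_def rot_def fst_conv snd_conv prod.inject
        by (rule conjI[OF 1[symmetric] 2[symmetric]])
    qed
    then have "rot t = (\<lambda>z. f (g (f z)))" by auto
    moreover have "area_preserving f" "area_preserving g" by (auto simp: f_def g_def area_preserving_shear1 area_preserving_shear2)
    ultimately show ?thesis by (metis area_preserving_comp)
  qed
  show ?thesis
  proof (cases "cos t = -1")
    case True
    have "cos t = 2 * (cos (t/2))\<^sup>2 - 1"
      using cos_double_cos[of "t/2"] by simp
    then have "cos (t/2) \<noteq> -1" using True by auto
    then have "area_preserving (\<lambda>z. rot (t/2) (rot (t/2) z))"
      using area_preserving_comp[of "rot (t/2)" "rot (t/2)"] * by blast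
    then show ?thesis by (simp add: rot_rot)
  qed (use * in auto)
qed

lemma floor_divide_approx:
  fixes N y :: real
  assumes "N > 0"
  shows "\<bar>of_int \<lfloor>N * y\<rfloor> / N - y\<bar> \<le> 1 / N"
proof -
  have "of_int \<lfloor>N * y\<rfloor> / N - y = (of_int \<lfloor>N * y\<rfloor> - N * y) / N"
    using assms by (simp add: field_simps)
  moreover have "\<bar>of_int \<lfloor>N * y\<rfloor> - N * y\<bar> \<le> 1" by linarith
  ultimately show ?thesis using assms by (simp add: divide_right_mono)
qed

text \<open>Round the angle down to a multiple of \<open>1 / Suc n\<close>. The rounded map
  \<open>T n\<close> is a rigid rotation on each of countably many rotation-invariant pieces, hence
  preserves area, and it converges pointwise to the twist. As \<open>A\<close> is open, a limit in
  \<open>A\<close> forces \<open>T n z\<close> into \<open>A\<close> from some \<open>n\<close> on,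
  and continuity of measure along an increasing union gives one inequality.\<close>

lemma emeasure_vimage_twist_le:
  fixes f :: "real \<Rightarrow> real"
  assumes f: "continuous_on UNIV f" and A: "open A"
  shows "emeasure lborel ((\<lambda>z. rot (f (norm z)) z) -` A) \<le> emeasure lborel A"
proof -
  define F where "F n r = of_int \<lfloor>real (Suc n) * f r\<rfloor> / real (Suc n)" for n r
  define T where "T n z = rot (F n (norm z)) z" for n z
  have [measurable]: "f \<in> borel_measurable borel"
    using f by (rule borel_measurable_continuous_onI)
  have [measurable]: "A \<in> sets borel" using A by auto
  have TA: "T n -` A \<in> sets lborel \<and> emeasure lborel (T n -` A) = emeasure lborel A" for n
  proof -
    define B where "B k = {z::real\<times>real. \<lfloor>real (Suc n) * f (norm z)\<rfloor> = k}" for k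
    define s where "s k = real_of_int k / real (Suc n)" for k
    have [measurable]: "B k \<in> sets borel" for k unfolding B_def by measurable
    have U: "T n -` A = (\<Union>k. B k \<inter> rot (s k) -` A)"
      by (auto simp: B_def T_def F_def s_def)
    have rB: "B k \<inter> rot (s k) -` A = rot (s k) -` (B k \<inter> A)" for k
      by (auto simp: B_def)
    have m: "B k \<inter> rot (s k) -` A \<in> sets lborel" for k
      unfolding rB using measurable_sets[OF rot_measurable, of "B k \<inter> A" "s k"] by simp
    have e: "emeasure lborel (B k \<inter> rot (s k) -` A) = emeasure lborel (B k \<inter> A)" for k
      unfolding rB using area_preserving_rot[of "s k"] unfolding area_preserving_def by (simp del: vimage_Int)
    have d: "disjoint_family (\<lambda>k. B k \<inter> rot (s k) -` A)" "disjoint_family (\<lambda>k. B k \<inter> A)"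
      by (auto simp: disjoint_family_on_def B_def)
    have "emeasure lborel (T n -` A) = (\<integral>\<^sup>+k. emeasure lborel (B k \<inter> rot (s k) -` A) \<partial>count_space UNIV)"
      unfolding U by (rule emeasure_UN_countable) (use m d in auto)
    also have "\<dots> = emeasure lborel (\<Union>k. B k \<inter> A)"
      unfolding e by (rule emeasure_UN_countable[symmetric]) (use d in auto)
    also have "(\<Union>k. B k \<inter> A) = A" by (auto simp: B_def)
    finally have "emeasure lborel (T n -` A) = emeasure lborel A" .
    moreover have "T n -` A \<in> sets lborel" unfolding U using m by (intro sets.countable_UN') auto
    ultimately show ?thesis by blast
  qed
  have lim: "(\<lambda>n. T n z) \<longlonglongrightarrow> rot (f (norm z)) z" for z
  proof -
    have "(\<lambda>n. F n (norm z)) \<longlonglongrightarrow> f (norm z)"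
    proof (rule LIMSEQ_I)
      fix e :: real assume "e > 0"
      then obtain N where N: "1 / real (Suc N) < e" using nat_approx_posE by blast
      have "norm (F n (norm z) - f (norm z)) < e" if "n \<ge> N" for n
      proof -
        have "\<bar>F n (norm z) - f (norm z)\<bar> \<le> 1 / real (Suc n)"
          unfolding F_def by (rule floor_divide_approx) simp
        also have "\<dots> \<le> 1 / real (Suc N)" using that by (simp add: field_simps)
        finally show ?thesis using N by simp
      qed
      then show "\<exists>N. \<forall>n\<ge>N. norm (F n (norm z) - f (norm z)) < e" by blast
    qed
    then show ?thesis unfolding T_def rot_def by (intro tendsto_intros)
  qed
  \<comment> \<open>The union of these increasing sets is the lower limit of the preimages of
    \<open>A\<close> under the \<open>T n\<close>.\<close>
  define C where "C N = (\<Inter>n\<in>{N..}. T n -` A)" for N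
  have C: "C N \<in> sets lborel" for N unfolding C_def using TA by (intro sets.countable_INT') auto
  have "(\<lambda>z. rot (f (norm z)) z) -` A \<subseteq> (\<Union>N. C N)"
  proof
    fix z assume "z \<in> (\<lambda>z. rot (f (norm z)) z) -` A"
    then have "eventually (\<lambda>n. T n z \<in> A) sequentially"
      using lim[of z] A topological_tendstoD by fastforce
    then show "z \<in> (\<Union>N. C N)" by (auto simp: C_def eventually_sequentially)
  qed
  then have "emeasure lborel ((\<lambda>z. rot (f (norm z)) z) -` A) \<le> emeasure lborel (\<Union>N. C N)"
    using C by (intro emeasure_mono sets.countable_UN') auto
  also have "\<dots> = (SUP N. emeasure lborel (C N))"
    using C by (intro SUP_emeasure_incseq[symmetric]) (auto simp: incseq_def C_def)
  also have "\<dots> \<le> emeasure lborel A"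
  proof (rule SUP_least)
    fix N show "emeasure lborel (C N) \<le> emeasure lborel A"
      using TA[of N] emeasure_mono[of "C N" "T N -` A" lborel] by (auto simp: C_def)
  qed
  finally show ?thesis .
qed

text \<open>The inverse is the twist with angle \<open>- f\<close>; the inequality for it, applied
  to the open preimage of \<open>A\<close>, is the missing one.\<close>

lemma emeasure_vimage_twist:
  fixes f :: "real \<Rightarrow> real"
  assumes f: "continuous_on UNIV f" and A: "open A"
  shows "emeasure lborel ((\<lambda>z. rot (f (norm z)) z) -` A) = emeasure lborel A"
proof (rule antisym[OF emeasure_vimage_twist_le[OF assms]])
  let ?t = "\<lambda>z. rot (f (norm z)) z" and ?u = "\<lambda>z. rot (- f (norm z)) z"
  have "open (?t -` A)"
    using A f by (intro open_vimage continuous_on_rot)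
      (auto intro!: continuous_intros continuous_on_compose2[OF f])
  then have "emeasure lborel (?u -` (?t -` A)) \<le> emeasure lborel (?t -` A)"
    using emeasure_vimage_twist_le[of "\<lambda>r. - f r" "?t -` A"] f by (simp add: continuous_on_minus)
  moreover have "?u -` (?t -` A) = A" by (simp add: vimage_def rot_rot)
  ultimately show "emeasure lborel A \<le> emeasure lborel (?t -` A)" by simp
qed

section \<open>Area preserving homeomorphisms moving points\<close>

text \<open>\<open>S\<close> contains the support; as a bijection fixing all points outside
  \<open>S\<close>, \<open>h\<close> maps \<open>S\<close> onto itself. Area is compared on open
  sets only, the kind of set to which \<open>chainable_area_preserving\<close> applies it, and for
  \<open>h\<close> and \<open>g\<close> alike, so that the pair can be swapped for backward
  orbits.\<close>

definition area_homeo :: "(real \<times> real) set \<Rightarrow> (real \<times> real \<Rightarrow> real \<times> real) \<Rightarrow> (real \<times> real \<Rightarrow> real \<times> real) \<Rightarrow> bool" where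
  "area_homeo S h g \<longleftrightarrow> continuous_on UNIV h \<and> continuous_on UNIV g \<and> (\<forall>x. g (h x) = x) \<and> (\<forall>x. h (g x) = x)
     \<and> (\<forall>A. open A \<longrightarrow> emeasure lborel (h -` A) = emeasure lborel A)
     \<and> (\<forall>A. open A \<longrightarrow> emeasure lborel (g -` A) = emeasure lborel A)
     \<and> (\<forall>x. x \<notin> S \<longrightarrow> h x = x)"

lemma area_homeoD:
  assumes "area_homeo S h g"
  shows "continuous_on UNIV h" "continuous_on UNIV g" "g (h x) = x" "h (g x) = x"
    "open A \<Longrightarrow> emeasure lborel (h -` A) = emeasure lborel A"
    "open A \<Longrightarrow> emeasure lborel (g -` A) = emeasure lborel A"
    "x \<notin> S \<Longrightarrow> h x = x"
  using assms by (simp_all add: area_homeo_def del: split_paired_All)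

lemma area_homeo_id: "area_homeo S (\<lambda>x. x) (\<lambda>x. x)"
  by (auto simp: area_homeo_def vimage_def)

lemma area_homeo_sym: "area_homeo S h g \<Longrightarrow> area_homeo S g h"
  unfolding area_homeo_def by metis

lemma area_homeo_mono: "area_homeo S h g \<Longrightarrow> S \<subseteq> T \<Longrightarrow> area_homeo T h g"
  unfolding area_homeo_def by blast

lemma area_homeo_comp:
  assumes "area_homeo S h g" "area_homeo S h' g'" shows "area_homeo S (\<lambda>x. h (h' x)) (\<lambda>x. g' (g x))"
proof -
  have m: "emeasure lborel ((\<lambda>x. a (b x)) -` A) = emeasure lborel A"
    if "open A" "continuous_on UNIV a" "\<And>A. open A \<Longrightarrow> emeasure lborel (a -` A) = emeasure lborel A"
      "\<And>A. open A \<Longrightarrow> emeasure lborel (b -` A) = emeasure lborel A"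
    for a b :: "real \<times> real \<Rightarrow> real \<times> real" and A
  proof -
    have "(\<lambda>x. a (b x)) -` A = b -` (a -` A)" by auto
    moreover have "open (a -` A)"
      using open_vimage[OF that(1,2)] .
    ultimately show ?thesis using that by simp
  qed
  note a = area_homeoD[OF assms(1)] and b = area_homeoD[OF assms(2)]
  have "continuous_on UNIV (\<lambda>x. h (h' x))" "continuous_on UNIV (\<lambda>x. g' (g x))"
    using continuous_on_compose2[OF a(1) b(1)] continuous_on_compose2[OF b(2) a(2)] by auto
  then show ?thesis
    unfolding area_homeo_def using a b m[of _ h h'] m[of _ g' g] by auto
qed

lemma area_homeo_in:
  assumes "area_homeo S h g" shows "h x \<in> S \<longleftrightarrow> x \<in> S"
  using area_homeoD[OF assms] area_homeoD[OF area_homeo_sym[OF assms]] by metis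

text \<open>A twist about the midpoint: a half turn on the disc of radius \<open>D/2\<close>, whose
  boundary carries \<open>p\<close> and \<open>q\<close>, with the angle falling linearly to zero at
  radius \<open>D\<close>.\<close>

lemma area_homeo_move_point_ball:
  assumes "p \<noteq> q"
  shows "\<exists>h g. area_homeo (ball (midpoint p q) (dist p q)) h g \<and> h p = q"
proof -
  define c where "c = midpoint p q"
  define D where "D = dist p q"
  have D: "D > 0" using assms by (simp add: D_def)
  define f where "f r = pi * max 0 (min 1 (2 - 2 * r / D))" for r
  have cf: "continuous_on UNIV f" unfolding f_def by (intro continuous_intros) (use D in auto)
  define tw where "tw s z = rot (s * f (norm z)) z" for s z
  define h where "h s z = c + tw s (- c + z)" for s z
  have ctw: "continuous_on UNIV (tw s)" for s
    unfolding tw_def by (intro continuous_on_rot continuous_intros continuous_on_compose2[OF cf]) auto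
  have ch: "continuous_on UNIV (h s)" for s
    unfolding h_def by (intro continuous_intros continuous_on_compose2[OF ctw]) auto
  have m: "emeasure lborel (h s -` A) = emeasure lborel A" if A: "open A" for s A
  proof -
    have A1: "open ((\<lambda>z. c + z) -` A)" using A by (intro open_vimage) (auto intro!: continuous_intros)
    then have A2: "open (tw s -` ((\<lambda>z. c + z) -` A))" by (rule open_vimage[OF _ ctw])
    have "h s -` A = (\<lambda>z. - c + z) -` (tw s -` ((\<lambda>z. c + z) -` A))" by (auto simp: h_def)
    then have "emeasure lborel (h s -` A) = emeasure lborel (tw s -` ((\<lambda>z. c + z) -` A))"
      using A2 emeasure_lborel_translate[of _ "- c"] by (metis borel_open)
    also have "\<dots> = emeasure lborel ((\<lambda>z. c + z) -` A)"
      unfolding tw_def by (rule emeasure_vimage_twist[OF _ A1]) (intro continuous_intros cf)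
    also have "\<dots> = emeasure lborel A" using A by (simp add: emeasure_lborel_translate)
    finally show ?thesis .
  qed
  have inv: "h (-s) (h s z) = z" for s z
    by (simp add: h_def tw_def rot_rot)
  have out: "h 1 z = z" if "z \<notin> ball c D" for z
  proof -
    have "norm (z - c) \<ge> D" using that by (simp add: dist_norm norm_minus_commute)
    then have "f (norm (z - c)) = 0" using D by (simp add: f_def field_simps)
    then show ?thesis by (simp add: h_def tw_def)
  qed
  have "area_homeo (ball c D) (h 1) (h (-1))"
    unfolding area_homeo_def using ch m inv[of 1] inv[of "-1"] out by auto
  moreover have "h 1 p = q"
  proof -
    have e: "p - c = (1/2) *\<^sub>R (p - q)" by (simp add: c_def midpoint_def algebra_simps flip: scaleR_add_left)
    then have "norm (p - c) = D / 2" by (simp add: D_def dist_norm)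
    then have "f (norm (p - c)) = pi" using D by (simp add: f_def)
    moreover have "rot pi z = - z" for z by (simp add: rot_def prod_eq_iff)
    ultimately show ?thesis using e by (simp add: h_def tw_def c_def midpoint_def algebra_simps flip: scaleR_add_left)
  qed
  ultimately show ?thesis unfolding c_def D_def by blast
qed

text \<open>Being movable to one another inside \<open>S\<close> is an equivalence relation whose
  classes are open, by twists in small balls; connectedness leaves a single class.\<close>

lemma area_homeo_move_point:
  assumes "open S" "connected S" "a \<in> S" "b \<in> S"
  shows "\<exists>h g. area_homeo S h g \<and> h a = b"
proof (rule connected_equivalence_relation[OF assms(2-4), where R="\<lambda>a b. \<exists>h g. area_homeo S h g \<and> h a = b"])
  fix a assume "a \<in> S"
  then obtain e where e: "e > 0" "ball a e \<subseteq> S" using assms(1) openE by blast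
  have "\<exists>h g. area_homeo S h g \<and> h a = x" if x: "x \<in> ball a (e/2)" for x
  proof (cases "a = x")
    case True then show ?thesis using area_homeo_id by blast
  next
    case False
    have "ball (midpoint a x) (dist a x) \<subseteq> ball a e"
    proof
      fix z assume "z \<in> ball (midpoint a x) (dist a x)"
      then have "dist (midpoint a x) z < dist a x" by simp
      moreover have "dist a (midpoint a x) = dist a x / 2" by (simp add: dist_midpoint)
      moreover have "2 * dist a x < e" using x by simp
      ultimately have "dist a z < e"
        using dist_triangle[of a z "midpoint a x"] zero_le_dist[of a x] by linarith
      then show "z \<in> ball a e" by simp
    qed
    then have "ball (midpoint a x) (dist a x) \<subseteq> S" using e by blast
    then show ?thesis using area_homeo_move_point_ball[OF False] area_homeo_mono by blast
  qed
  moreover have "openin (top_of_set S) (ball a (e/2))"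
    using e assms(1) by (intro open_openin_trans) auto
  ultimately show "\<exists>T. openin (top_of_set S) T \<and> a \<in> T \<and> (\<forall>x\<in>T. \<exists>h g. area_homeo S h g \<and> h a = x)"
    using e by (intro exI[of _ "ball a (e/2)"]) auto
next
  fix x y z assume "\<exists>h g. area_homeo S h g \<and> h x = y" "\<exists>h g. area_homeo S h g \<and> h y = z"
  then show "\<exists>h g. area_homeo S h g \<and> h x = z" using area_homeo_comp by metis
next
  fix x y assume "\<exists>h g. area_homeo S h g \<and> h x = y"
  then show "\<exists>h g. area_homeo S h g \<and> h y = x" using area_homeo_sym area_homeoD(3) by metis
qed

section \<open>Moving finitely many points at once\<close>

definition nbhd :: "'a::metric_space set \<Rightarrow> real \<Rightarrow> 'a set" where
  "nbhd K r = (\<Union>x\<in>K. ball x r)"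

lemma open_nbhd: "open (nbhd K r)"
  by (auto simp: nbhd_def)

lemma subset_nbhd: "r > 0 \<Longrightarrow> K \<subseteq> nbhd K r"
  by (auto simp: nbhd_def)

lemma connected_nbhd:
  fixes K :: "'a::real_normed_vector set"
  assumes "connected K" "K \<noteq> {}" "r > 0"
  shows "connected (nbhd K r)"
proof -
  have "connected (K \<union> ball x r)" if "x \<in> K" for x
    using that assms by (intro connected_Un) auto
  then have "connected (\<Union>x\<in>K. K \<union> ball x r)"
    using assms by (intro connected_Union) auto
  moreover have "(\<Union>x\<in>K. K \<union> ball x r) = nbhd K r"
    using assms by (auto simp: nbhd_def)
  ultimately show ?thesis by simp
qed

text \<open>Homeomorphisms with disjoint supports do not interfere, so they are composed one by one.
  The invariance of each \<open>S i\<close> is carried along because it later bounds the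
  displacement.\<close>

lemma area_homeo_move_points_disjoint:
  assumes "finite I"
    and "\<And>i. i \<in> I \<Longrightarrow> open (S i) \<and> connected (S i) \<and> a i \<in> S i \<and> b i \<in> S i"
    and "disjoint_family_on S I"
  shows "\<exists>h g. area_homeo (\<Union>i\<in>I. S i) h g \<and> (\<forall>i\<in>I. h (a i) = b i \<and> h ` S i \<subseteq> S i)"
  using assms
proof (induction I rule: finite_induct)
  case empty
  then show ?case using area_homeo_id by auto
next
  case (insert j I)
  have dj: "S i \<inter> S j = {}" if "i \<in> I" for i
  proof -
    have "i \<noteq> j" using insert.hyps(2) that by blast
    then show ?thesis using disjoint_family_onD[OF insert.prems(2), of i j] that by simp
  qed
  have "disjoint_family_on S I"
    using insert.prems(2) by (auto simp: disjoint_family_on_def)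
  then obtain h g where h: "area_homeo (\<Union>i\<in>I. S i) h g" "\<forall>i\<in>I. h (a i) = b i \<and> h ` S i \<subseteq> S i"
    using insert.IH insert.prems(1) by auto
  obtain h' g' where h': "area_homeo (S j) h' g'" "h' (a j) = b j"
    using area_homeo_move_point[of "S j" "a j" "b j"] insert.prems(1) by auto
  have "area_homeo (\<Union>i\<in>insert j I. S i) (\<lambda>x. h' (h x)) (\<lambda>x. g (g' x))"
    by (rule area_homeo_comp[OF area_homeo_mono[OF h'(1)] area_homeo_mono[OF h(1)]]) auto
  moreover have "h' (h (a i)) = b i \<and> (\<lambda>x. h' (h x)) ` S i \<subseteq> S i" if i: "i \<in> insert j I" for i
  proof (cases "i = j")
    case True
    have "h x = x" if "x \<in> S j" for x
      using area_homeoD(7)[OF h(1)] dj that by blast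
    then show ?thesis using True h' area_homeo_in[OF h'(1)] insert.prems(1)[of j] by auto
  next
    case False
    then have "i \<in> I" using i by auto
    have "h' x = x" if "x \<in> S i" for x
      using area_homeoD(7)[OF h'(1)] dj[OF \<open>i \<in> I\<close>] that by blast
    moreover have "h x \<in> S i" if "x \<in> S i" for x using h(2) \<open>i \<in> I\<close> that by blast
    ultimately show ?thesis using h(2) \<open>i \<in> I\<close> insert.prems(1)[OF i] by (simp add: image_subset_iff)
  qed
  ultimately show ?case by (intro exI[of _ "\<lambda>x. h' (h x)"] exI[of _ "\<lambda>x. g (g' x)"]) auto
qed

text \<open>Only the segments are disjoint; the sets \<open>B i\<close> may overlap. Thin tubes
  around the segments are open, connected, pairwise disjoint and inside the \<open>B i\<close>, and
  each tube is treated separately.\<close>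

lemma area_homeo_move_segments:
  fixes a b :: "'i \<Rightarrow> real \<times> real"
  assumes I: "finite I"
    and B: "\<And>i. i \<in> I \<Longrightarrow> open (B i) \<and> closed_segment (a i) (b i) \<subseteq> B i"
    and d: "disjoint_family_on (\<lambda>i. closed_segment (a i) (b i)) I"
  shows "\<exists>h g. area_homeo (\<Union>i\<in>I. B i) h g \<and> (\<forall>i\<in>I. h (a i) = b i)
           \<and> (\<forall>x. h x = x \<or> (\<exists>i\<in>I. x \<in> B i \<and> h x \<in> B i))"
proof -
  let ?s = "\<lambda>i. closed_segment (a i) (b i)"
  \<comment> \<open>The clearance of a segment from the complement of \<open>B i\<close> and from
    all other segments; tubes of half that width are disjoint.\<close>
  have "\<exists>e>0. \<forall>x\<in>?s i. \<forall>y \<in> - B i \<union> (\<Union>j\<in>I-{i}. ?s j). e \<le> dist x y" if i: "i \<in> I" for i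
  proof -
    have "closed (- B i \<union> (\<Union>j\<in>I-{i}. ?s j))"
      using B[OF i] I by (intro closed_Un closed_UN) auto
    moreover have "?s i \<inter> (- B i \<union> (\<Union>j\<in>I-{i}. ?s j)) = {}"
      using B[OF i] d i unfolding disjoint_family_on_def by blast
    ultimately show ?thesis
      using separate_compact_closed[OF compact_segment] by blast
  qed
  then have "\<forall>i\<in>I. \<exists>e. e > 0 \<and> (\<forall>x\<in>?s i. \<forall>y \<in> - B i \<union> (\<Union>j\<in>I-{i}. ?s j). e \<le> dist x y)"
    by auto
  from bchoice[OF this] obtain e
    where e': "\<forall>i\<in>I. e i > 0 \<and> (\<forall>x\<in>?s i. \<forall>y \<in> - B i \<union> (\<Union>j\<in>I-{i}. ?s j). e i \<le> dist x y)" ..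
  have e: "\<And>i. i \<in> I \<Longrightarrow> e i > 0"
     "\<And>i x y. i \<in> I \<Longrightarrow> x \<in> ?s i \<Longrightarrow> y \<in> - B i \<union> (\<Union>j\<in>I-{i}. ?s j) \<Longrightarrow> e i \<le> dist x y"
    using e' by auto
  define S where "S i = nbhd (?s i) (e i / 2)" for i
  have SB: "S i \<subseteq> B i" if "i \<in> I" for i
  proof
    fix y assume "y \<in> S i"
    then obtain x where x: "x \<in> ?s i" "dist x y < e i / 2" by (auto simp: S_def nbhd_def)
    show "y \<in> B i"
    proof (rule ccontr)
      assume "y \<notin> B i"
      then have "e i \<le> dist x y" using e(2)[OF that x(1)] by blast
      then show False using x e(1)[OF that] by linarith
    qed
  qed
  have "disjoint_family_on S I"
    unfolding disjoint_family_on_def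
  proof (intro ballI impI equals0I)
    fix i j z assume ij: "i \<in> I" "j \<in> I" "i \<noteq> j" and "z \<in> S i \<inter> S j"
    then obtain x y where x: "x \<in> ?s i" "dist x z < e i / 2" and y: "y \<in> ?s j" "dist y z < e j / 2"
      by (auto simp: S_def nbhd_def)
    then have "e i \<le> dist x y" "e j \<le> dist y x"
      using ij by (auto intro!: e(2))
    then show False using x y dist_triangle2[of x y z] by (simp add: dist_commute)
  qed
  moreover have "open (S i) \<and> connected (S i) \<and> a i \<in> S i \<and> b i \<in> S i" if "i \<in> I" for i
    using e(1)[OF that] subset_nbhd[of "e i / 2" "?s i"]
    by (auto simp: S_def open_nbhd intro!: connected_nbhd)
  ultimately obtain h g where h: "area_homeo (\<Union>i\<in>I. S i) h g" "\<And>i. i \<in> I \<Longrightarrow> h (a i) = b i \<and> h ` S i \<subseteq> S i"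
    using area_homeo_move_points_disjoint[OF I, of S a b] by blast
  have "h x = x \<or> (\<exists>i\<in>I. x \<in> B i \<and> h x \<in> B i)" for x
  proof (cases "x \<in> (\<Union>i\<in>I. S i)")
    case True
    then show ?thesis using h(2) SB by blast
  qed (use area_homeoD(7)[OF h(1)] in auto)
  moreover have "area_homeo (\<Union>i\<in>I. B i) h g" using SB by (intro area_homeo_mono[OF h(1)]) auto
  ultimately show ?thesis using h(2) by blast
qed

text \<open>Each nonzero vector of \<open>P\<close> forbids at most one slope. The bound
  \<open>1/2\<close> keeps the detours in \<open>area_homeo_realize\<close> short.\<close>

lemma exists_generic_slope:
  assumes "finite P"
  shows "\<exists>s::real. 0 < s \<and> s < 1/2 \<and> (\<forall>v\<in>P. v \<noteq> (0::real\<times>real) \<longrightarrow> snd v \<noteq> s * fst v)"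
proof -
  have "infinite ({0<..<1/2} - (\<lambda>v. snd v / fst v) ` P)"
    using assms by (intro Diff_infinite_finite) (auto simp: infinite_Ioo)
  then obtain s where s: "s \<in> {0<..<1/2}" "s \<notin> (\<lambda>v. snd v / fst v) ` P"
    using infinite_imp_nonempty by blast
  have "snd v \<noteq> s * fst v" if "v \<in> P" "v \<noteq> 0" for v
  proof
    assume *: "snd v = s * fst v"
    then have "fst v \<noteq> 0" using that by (auto simp: prod_eq_iff)
    then have "s = snd v / fst v" using * by simp
    then show False using s that by blast
  qed
  then show ?thesis using s by auto
qed

lemma disjoint_parallel_segments:
  fixes p :: "'i \<Rightarrow> real \<times> real"
  assumes inj: "inj_on p I"
    and u: "\<And>i j k. i \<in> I \<Longrightarrow> j \<in> I \<Longrightarrow> p i \<noteq> p j \<Longrightarrow> p i - p j \<noteq> k *\<^sub>R u"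
    and r: "\<And>i. i \<in> I \<Longrightarrow> r i = p i + \<alpha> i *\<^sub>R u"
  shows "disjoint_family_on (\<lambda>i. closed_segment (p i) (r i)) I"
  unfolding disjoint_family_on_def
proof (intro ballI impI equals0I)
  fix i j z assume ij: "i \<in> I" "j \<in> I" "i \<noteq> j" and z: "z \<in> closed_segment (p i) (r i) \<inter> closed_segment (p j) (r j)"
  have "\<exists>k. z = p i + k *\<^sub>R u" if "i \<in> I" and zi: "z \<in> closed_segment (p i) (r i)" for i
  proof -
    obtain t where "z = (1 - t) *\<^sub>R p i + t *\<^sub>R r i" using zi unfolding closed_segment_def by blast
    then have "z = p i + (t * \<alpha> i) *\<^sub>R u" using r[OF \<open>i \<in> I\<close>] by (simp add: algebra_simps)
    then show ?thesis by blast
  qed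
  then obtain k l where "z = p i + k *\<^sub>R u" "z = p j + l *\<^sub>R u" using ij z by blast
  then have "p i - p j = (l - k) *\<^sub>R u"
    by (metis (no_types, lifting) add_diff_cancel_left' add_diff_eq diff_add_eq diff_diff_eq2 scaleR_left_diff_distrib)
  then show False using u[OF ij(1,2)] inj ij by (auto simp: inj_on_def)
qed

text \<open>Each point travels from \<open>p i\<close> to \<open>q i\<close> along two legs whose directions are generic, so that all
  first legs are pairwise disjoint, and so are all second legs.\<close>

lemma area_homeo_realize:
  fixes p q :: "'i \<Rightarrow> real \<times> real" and \<delta> :: "real \<times> real \<Rightarrow> real"
  assumes I: "finite I" and p: "inj_on p I" and q: "inj_on q I"
    and lip: "\<And>x y. \<delta> x \<le> \<delta> y + dist x y"
    and le: "\<And>x. \<delta> x \<le> infdist x (- X)"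
    and close: "\<And>i. i \<in> I \<Longrightarrow> dist (p i) (q i) < \<delta> (p i) / 32"
    and nonneg: "\<And>x. 0 \<le> \<delta> x"
  shows "\<exists>h g. area_homeo X h g \<and> (\<forall>i\<in>I. h (p i) = q i) \<and> (\<forall>x. dist (h x) x \<le> \<delta> x)
           \<and> (\<exists>r>0. \<forall>x. infdist x (- X) < r \<longrightarrow> h x = x)"
proof -
  have pos: "\<delta> (p i) > 0" if "i \<in> I" for i
    using close[OF that] zero_le_dist[of "p i" "q i"] by linarith
  obtain s where s: "0 < s" "s < 1/2" "\<And>i j. i \<in> I \<Longrightarrow> j \<in> I \<Longrightarrow> p i \<noteq> p j \<Longrightarrow> snd (p i - p j) \<noteq> s * fst (p i - p j)"
    using exists_generic_slope[of "(\<lambda>(i,j). p i - p j) ` (I \<times> I)"] I by force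
  \<comment> \<open>The differences are turned by a right angle before the slope is chosen, since
    the second legs run in direction \<open>(-t, 1)\<close>.\<close>
  obtain t where t: "0 < t" "t < 1/2" "\<And>i j. i \<in> I \<Longrightarrow> j \<in> I \<Longrightarrow> q i \<noteq> q j \<Longrightarrow> - fst (q i - q j) \<noteq> t * snd (q i - q j)"
    using exists_generic_slope[of "(\<lambda>(i,j). (snd (q i - q j), - fst (q i - q j))) ` (I \<times> I)"] I
    by (force simp: prod_eq_iff)
  define d where "d i = q i - p i" for i
  \<comment> \<open>\<open>\<alpha>\<close> and \<open>\<beta>\<close> solve \<open>d i = \<alpha> i
    *\<^sub>R (1, s) - \<beta> i *\<^sub>R (-t, 1)\<close>, so the corner \<open>r i\<close> lies on
    both legs.\<close>
  define \<alpha> where "\<alpha> i = (fst (d i) + t * snd (d i)) / (1 + s * t)" for i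
  define \<beta> where "\<beta> i = \<alpha> i * s - snd (d i)" for i
  define r where "r i = p i + \<alpha> i *\<^sub>R (1, s)" for i
  have st: "1 + s * t > 0" "1 + s * t \<ge> 1" using s t by (simp_all add: pos_add_strict)
  have r2: "r i = q i + \<beta> i *\<^sub>R (-t, 1)" for i
  proof -
    have "\<alpha> i * (1 + s * t) = fst (d i) + t * snd (d i)" using st by (simp add: \<alpha>_def)
    then have "\<alpha> i + \<beta> i * t = fst (d i)" by (simp add: \<beta>_def algebra_simps)
    then show ?thesis
      by (simp add: r_def \<beta>_def d_def prod_eq_iff algebra_simps)
  qed
  \<comment> \<open>The first leg has length at most \<open>3 * dist (p i) (q i)\<close>, below
    \<open>3/32 * \<delta> (p i)\<close> by \<open>close\<close>; so \<open>p i\<close>,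
    \<open>r i\<close> and \<open>q i\<close> lie in this ball, and by convexity both legs
    do.\<close>
  define B where "B i = ball (p i) (\<delta> (p i) / 8)" for i
  have oB: "open (B i)" for i by (simp add: B_def)
  have pB: "p i \<in> B i" if "i \<in> I" for i using pos[OF that] by (simp add: B_def)
  have qB: "q i \<in> B i" if "i \<in> I" for i
    using close[OF that] pos[OF that] by (simp add: B_def)
  have rB: "r i \<in> B i" if "i \<in> I" for i
  proof -
    have 1: "\<bar>fst (d i)\<bar> \<le> norm (d i)" "\<bar>snd (d i)\<bar> \<le> norm (d i)"
      using norm_fst_le[of "fst (d i)" "snd (d i)"] norm_snd_le[of "snd (d i)" "fst (d i)"] by auto
    have "\<bar>t * snd (d i)\<bar> \<le> norm (d i)"
      using 1 t mult_mono[of t 1 "\<bar>snd (d i)\<bar>" "norm (d i)"] by (simp add: abs_mult)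
    then have "\<bar>fst (d i) + t * snd (d i)\<bar> \<le> 2 * norm (d i)" using 1 by linarith
    moreover have "\<bar>\<alpha> i\<bar> \<le> \<bar>fst (d i) + t * snd (d i)\<bar>"
      using st divide_left_mono[of 1 "1+s*t" "\<bar>fst (d i) + t * snd (d i)\<bar>"] by (simp add: \<alpha>_def abs_divide)
    ultimately have a: "\<bar>\<alpha> i\<bar> \<le> 2 * norm (d i)" by linarith
    have "norm (1::real, s) \<le> norm (1::real) + norm s" by (rule norm_Pair_le)
    then have n: "norm (1::real, s) \<le> 3/2" using s by simp
    have "norm (\<alpha> i *\<^sub>R (1::real, s)) = \<bar>\<alpha> i\<bar> * norm (1::real, s)" by (rule norm_scaleR)
    then have "norm (\<alpha> i *\<^sub>R (1::real, s)) \<le> 2 * norm (d i) * (3/2)"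
      using mult_mono[OF a n] by simp
    moreover have "dist (p i) (r i) = norm (\<alpha> i *\<^sub>R (1::real, s))"
      by (metis add_diff_cancel_left' dist_commute dist_norm r_def)
    moreover have "norm (d i) = dist (p i) (q i)"
      by (simp only: d_def dist_norm norm_minus_commute)
    ultimately have "dist (p i) (r i) \<le> 3 * dist (p i) (q i)" by linarith
    then show ?thesis using close[OF that] pos[OF that] by (simp add: B_def)
  qed
  have Bc: "closed_segment x y \<subseteq> B i" if "x \<in> B i" "y \<in> B i" for x y i
    using that closed_segment_subset[of x "B i" y] by (simp add: B_def)
  have d1: "disjoint_family_on (\<lambda>i. closed_segment (p i) (r i)) I"
  proof (rule disjoint_parallel_segments[OF p _ r_def])
    show "p i - p j \<noteq> k *\<^sub>R (1, s)" if "i \<in> I" "j \<in> I" "p i \<noteq> p j" for i j k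
      using s(3)[OF that] by (cases "p i - p j") auto
  qed
  have d2: "disjoint_family_on (\<lambda>i. closed_segment (q i) (r i)) I"
  proof (rule disjoint_parallel_segments[OF q _ r2])
    show "q i - q j \<noteq> k *\<^sub>R (-t, 1)" if "i \<in> I" "j \<in> I" "q i \<noteq> q j" for i j k
      using t(3)[OF that] by (cases "q i - q j") auto
  qed
  have "\<exists>h g. area_homeo (\<Union>i\<in>I. B i) h g \<and> (\<forall>i\<in>I. h (p i) = r i)
           \<and> (\<forall>x. h x = x \<or> (\<exists>i\<in>I. x \<in> B i \<and> h x \<in> B i))"
    by (rule area_homeo_move_segments[OF I]) (use d1 oB pB rB Bc in auto)
  then obtain h1 g1 where h1: "area_homeo (\<Union>i\<in>I. B i) h1 g1" "\<And>i. i \<in> I \<Longrightarrow> h1 (p i) = r i"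
      "\<And>x. h1 x = x \<or> (\<exists>i\<in>I. x \<in> B i \<and> h1 x \<in> B i)" by blast
  have "\<exists>h g. area_homeo (\<Union>i\<in>I. B i) h g \<and> (\<forall>i\<in>I. h (r i) = q i)
           \<and> (\<forall>x. h x = x \<or> (\<exists>i\<in>I. x \<in> B i \<and> h x \<in> B i))"
  proof (rule area_homeo_move_segments[OF I])
    show "disjoint_family_on (\<lambda>i. closed_segment (r i) (q i)) I"
      using d2 by (simp add: closed_segment_commute)
  qed (use oB Bc rB qB in auto)
  then obtain h2 g2 where h2: "area_homeo (\<Union>i\<in>I. B i) h2 g2" "\<And>i. i \<in> I \<Longrightarrow> h2 (r i) = q i"
      "\<And>x. h2 x = x \<or> (\<exists>i\<in>I. x \<in> B i \<and> h2 x \<in> B i)" by blast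
  have lowB: "\<delta> (p i) \<le> 8/7 * \<delta> x" if "x \<in> B i" for x i
    using lip[of "p i" x] that by (simp add: B_def)
  have disp: "dist y x \<le> 2/7 * \<delta> x" if "y = x \<or> (\<exists>i\<in>I. x \<in> B i \<and> y \<in> B i)" for x y
    using that
  proof
    assume "\<exists>i\<in>I. x \<in> B i \<and> y \<in> B i"
    then obtain i where i: "x \<in> B i" "y \<in> B i" by blast
    then have "dist y x < \<delta> (p i) / 4"
      using dist_triangle3[of y x "p i"] by (simp add: B_def)
    then show ?thesis using lowB[OF i(1)] by linarith
  qed (use nonneg in simp)
  \<comment> \<open>The second move is measured at \<open>h1 x\<close>, where
    \<open>\<delta>\<close> is at most \<open>9/7 * \<delta> x\<close>, and
    \<open>2/7 + 2/7 * 9/7 < 1\<close>.\<close>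
  have dist_h: "dist (h2 (h1 x)) x \<le> \<delta> x" for x
  proof -
    have 1: "dist (h1 x) x \<le> 2/7 * \<delta> x" using disp[OF h1(3)] .
    have 2: "dist (h2 (h1 x)) (h1 x) \<le> 2/7 * \<delta> (h1 x)" using disp[OF h2(3)] .
    have "dist (h2 (h1 x)) x \<le> dist (h2 (h1 x)) (h1 x) + dist (h1 x) x" by (rule dist_triangle)
    then show ?thesis using 1 2 lip[of "h1 x" x] nonneg[of x] by linarith
  qed
  have BX: "B i \<subseteq> X" if "i \<in> I" for i
  proof
    fix x assume "x \<in> B i"
    then have "0 < infdist x (-X)" using lowB[of x i] pos[OF that] le[of x] by linarith
    then show "x \<in> X" by (metis ComplI infdist_zero less_irrefl)
  qed
  define \<rho> where "\<rho> = Min (insert 1 ((\<lambda>i. 7/8 * \<delta> (p i)) ` I))"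
  have "\<rho> > 0" using I pos by (auto simp: \<rho>_def)
  moreover have "h2 (h1 x) = x" if "infdist x (-X) < \<rho>" for x
  proof -
    have "x \<notin> B i" if "i \<in> I" for i
    proof
      assume "x \<in> B i"
      then have "7/8 * \<delta> (p i) \<le> infdist x (-X)" using lowB[of x i] le[of x] by simp
      moreover have "\<rho> \<le> 7/8 * \<delta> (p i)" unfolding \<rho>_def using I that by (intro Min_le) auto
      ultimately show False using \<open>infdist x (-X) < \<rho>\<close> by linarith
    qed
    then show ?thesis using h1(3)[of x] h2(3)[of x] by auto
  qed
  moreover have "area_homeo X (\<lambda>x. h2 (h1 x)) (\<lambda>x. g1 (g2 x))"
    by (rule area_homeo_comp[OF area_homeo_mono[OF h2(1)] area_homeo_mono[OF h1(1)]]) (use BX in auto)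
  ultimately show ?thesis
    using dist_h h1(2) h2(2) by (intro exI[of _ "\<lambda>x. h2 (h1 x)"] exI[of _ "\<lambda>x. g1 (g2 x)"]) auto
qed

section \<open>Chains of pseudo-orbits\<close>

lemma open_avoid_countable:
  fixes V :: "(real \<times> real) set"
  assumes "open V" "V \<noteq> {}" "countable Z"
  shows "\<exists>y\<in>V. y \<notin> Z"
proof -
  obtain x where "x \<in> V" using assms by blast
  then obtain e where e: "e > 0" "ball x e \<subseteq> V" using assms(1) openE by blast
  have "uncountable (ball x e)" using e(1) by (rule uncountable_ball)
  then have "\<not> ball x e \<subseteq> Z" using assms(3) countable_subset by blast
  then show ?thesis using e by blast
qed

text \<open>In a chain of minimal length no point recurs, since the loop could be cut out.\<close>

lemma rtrancl_injective_chain: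
  assumes "(a, b) \<in> r\<^sup>*"
  shows "\<exists>n f. f 0 = a \<and> f n = b \<and> (\<forall>t<n. (f t, f (Suc t)) \<in> r) \<and> inj_on f {..n::nat}"
proof -
  have "\<exists>n. (a, b) \<in> r ^^ n" using assms by (simp add: rtrancl_power)
  then obtain n where n: "(a, b) \<in> r ^^ n" and min: "\<And>k. k < n \<Longrightarrow> (a, b) \<notin> r ^^ k"
    using exists_least_iff[of "\<lambda>n. (a, b) \<in> r ^^ n"] by blast
  obtain f where f: "f 0 = a" "f n = b" "\<forall>t<n. (f t, f (Suc t)) \<in> r"
    using n by (auto simp: relpow_fun_conv)
  have "f i \<noteq> f j" if "i < j" "j \<le> n" for i j
  proof
    assume eq: "f i = f j"
    have "(a, f i) \<in> r ^^ i"
      unfolding relpow_fun_conv using f that by (intro exI[of _ f]) auto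
    moreover have "(f j, b) \<in> r ^^ (n - j)"
      unfolding relpow_fun_conv using f that by (intro exI[of _ "\<lambda>t. f (j + t)"]) auto
    ultimately have "(a, b) \<in> r ^^ (i + (n - j))"
      unfolding relpow_add eq by blast
    moreover have "i + (n - j) < n" using that by linarith
    ultimately show False using min by blast
  qed
  then have "inj_on f {..n}"
    by (intro linorder_inj_onI) auto
  then show ?thesis using f by blast
qed

text \<open>Chain transitivity in the form needed to prolong an orbit. New points must differ from
  each other, from existing orbit points and from all starting points, which the countable set
  \<open>Z\<close> will collect. Only the start of the chain, the end of an existing segment, lies
  in \<open>Z\<close>; \<open>0 < n\<close> forces real progress.\<close>

definition chainable :: "((real \<times> real) \<times> (real \<times> real)) set \<Rightarrow> (real \<times> real) set \<Rightarrow> bool" where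
  "chainable r U \<longleftrightarrow> (\<forall>Z a G. countable Z \<longrightarrow> a \<in> U \<inter> Z \<longrightarrow> open G \<longrightarrow> G \<subseteq> U \<longrightarrow> G \<noteq> {} \<longrightarrow>
     (\<exists>n f. 0 < n \<and> f 0 = a \<and> f n \<in> G \<and> (\<forall>t<n. (f t, f (Suc t)) \<in> r)
        \<and> (\<forall>t. 0 < t \<and> t \<le> n \<longrightarrow> f t \<in> U - Z) \<and> inj_on f {..n::nat}))"

lemma chainableE:
  assumes "chainable r U" "countable Z" "a \<in> U" "a \<in> Z" "open G" "G \<subseteq> U" "G \<noteq> {}"
  obtains n f where "0 < n" "f 0 = a" "f n \<in> G" "\<And>t. t < n \<Longrightarrow> (f t, f (Suc t)) \<in> r"
    "\<And>t. 0 < t \<Longrightarrow> t \<le> n \<Longrightarrow> f t \<in> U - Z" "inj_on f {..n::nat}"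
  using assms unfolding chainable_def by (metis IntI)

lemma chainable_mono:
  assumes "chainable r U" "r \<subseteq> r'" shows "chainable r' U"
  unfolding chainable_def
proof (intro allI impI)
  fix Z a G assume *: "countable Z" "a \<in> U \<inter> Z" "open G" "G \<subseteq> U" "G \<noteq> {}"
  then obtain n f where "0 < n" "f 0 = a" "f n \<in> G" "\<And>t. t < n \<Longrightarrow> (f t, f (Suc t)) \<in> r"
    "\<And>t. 0 < t \<Longrightarrow> t \<le> n \<Longrightarrow> f t \<in> U - Z" "inj_on f {..n::nat}"
    using chainableE[OF assms(1)] by (metis IntE)
  then show "\<exists>n f. 0 < n \<and> f 0 = a \<and> f n \<in> G \<and> (\<forall>t<n. (f t, f (Suc t)) \<in> r')
        \<and> (\<forall>t. 0 < t \<and> t \<le> n \<longrightarrow> f t \<in> U - Z) \<and> inj_on f {..n::nat}"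
    using assms(2) by (intro exI[of _ n] exI[of _ f]) auto
qed

text \<open>The open set \<open>R\<close> of points reached from \<open>a\<close> is mapped into itself by \<open>\<psi>\<close>. As \<open>\<psi>\<close> preserves
  area, \<open>\<psi> ` R\<close> is dense in \<open>R\<close>, and then \<open>R\<close> is also closed in \<open>U\<close>.\<close>

lemma chainable_area_preserving:
  assumes U: "open U" "connected U" "bounded U"
    and \<psi>: "area_homeo U \<psi> \<phi>"
    and r: "open r" "r \<subseteq> U \<times> U" "\<And>x. x \<in> U \<Longrightarrow> (x, \<psi> x) \<in> r"
  shows "chainable r U"
  unfolding chainable_def
proof (intro allI impI)
  fix Z a G assume Z: "countable Z" and a: "a \<in> U \<inter> Z" and G: "open G" "G \<subseteq> U" "G \<noteq> {}"
  define r0 where "r0 = r \<inter> (UNIV \<times> - Z)"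
  define R0 where "R0 = {y. (a, y) \<in> r0\<^sup>*}"
  \<comment> \<open>The last step uses \<open>r\<close> instead of \<open>r0\<close>: this makes
    \<open>R\<close> open, while points of \<open>R\<close> outside \<open>Z\<close> still belong to
    \<open>R0\<close>.\<close>
  define R where "R = r `` R0"
  note \<psi>' = area_homeoD[OF \<psi>] and \<psi>in = area_homeo_in[OF \<psi>] and \<phi>in = area_homeo_in[OF area_homeo_sym[OF \<psi>]]
  have slice1: "open (r `` {y})" for y
  proof -
    have "r `` {y} = Pair y -` r" by auto
    then show ?thesis using r(1) by (auto intro!: open_vimage continuous_intros)
  qed
  have slice2: "open {x. (x, y) \<in> r}" for y
  proof -
    have "{x. (x, y) \<in> r} = (\<lambda>x. (x, y)) -` r" by auto
    then show ?thesis using r(1) by (auto intro!: open_vimage continuous_intros)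
  qed
  have "R = (\<Union>y\<in>R0. r `` {y})" by (auto simp: R_def)
  then have oR: "open R" using slice1 by auto
  have RU: "R \<subseteq> U" using r(2) by (auto simp: R_def)
  have R0: "y \<in> R0" if "y \<in> R" "y \<notin> Z" for y
  proof -
    obtain x where "x \<in> R0" "(x, y) \<in> r" using \<open>y \<in> R\<close> unfolding R_def by blast
    then show ?thesis using that unfolding R0_def r0_def
      by (auto intro: rtrancl.rtrancl_into_rtrancl)
  qed
  \<comment> \<open>\<open>x\<close> itself may lie in \<open>Z\<close>. The predecessors of
    \<open>y\<close> in \<open>R\<close> form a nonempty open set, so one outside \<open>Z\<close>
    can replace it.\<close>
  have step: "y \<in> R" if "x \<in> R" "(x, y) \<in> r" for x y
  proof -
    have "open (R \<inter> {x. (x, y) \<in> r})" by (rule open_Int[OF oR slice2])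
    moreover have "R \<inter> {x. (x, y) \<in> r} \<noteq> {}" using that by blast
    ultimately obtain x' where "x' \<in> R" "(x', y) \<in> r" "x' \<notin> Z"
      using open_avoid_countable[OF _ _ Z] by blast
    then have "x' \<in> R0" using R0 by blast
    then show ?thesis using \<open>(x', y) \<in> r\<close> unfolding R_def by blast
  qed
  have o\<phi>: "open (\<phi> -` R)" by (rule open_vimage[OF oR \<psi>'(2)])
  have sub: "\<phi> -` R \<subseteq> R"
  proof
    fix y assume "y \<in> \<phi> -` R"
    then have "\<phi> y \<in> R" by simp
    then show "y \<in> R" using step[of "\<phi> y" y] r(3)[of "\<phi> y"] RU \<psi>'(4) by auto
  qed
  have dense: "R \<subseteq> closure (\<phi> -` R)"
  proof -
    let ?V = "R - closure (\<phi> -` R)"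
    have oV: "open ?V" using oR by (intro open_Diff) auto
    \<comment> \<open>Boundedness of \<open>U\<close> enters here: only a finite area can be
      cancelled.\<close>
    have fin: "emeasure lborel R \<noteq> \<infinity>"
      using emeasure_bounded_finite[OF bounded_subset[OF U(3) RU]] by simp
    have "emeasure lborel (\<phi> -` R) + emeasure lborel ?V = emeasure lborel (\<phi> -` R \<union> ?V)"
    proof (rule plus_emeasure)
      show "\<phi> -` R \<inter> ?V = {}" using closure_subset[of "\<phi> -` R"] by blast
    qed (use o\<phi> oV in auto)
    also have "\<dots> \<le> emeasure lborel R" using sub oR by (intro emeasure_mono) auto
    also have "\<dots> = emeasure lborel (\<phi> -` R) + 0" using \<psi>'(6)[OF oR] by simp
    finally have "emeasure lborel ?V = 0"
      using fin \<psi>'(6)[OF oR] by (simp add: ennreal_add_left_cancel_le)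
    then have "?V \<in> null_sets lborel" using oV by (auto simp: null_sets_def)
    then have "negligible ?V"
      using null_sets_completionI negligible_iff_null_sets by blast
    then have "?V = {}" using oV open_not_negligible by blast
    then show ?thesis by blast
  qed
  \<comment> \<open>The predecessors \<open>N\<close> of \<open>y\<close> form a neighbourhood of
    \<open>\<phi> y\<close>. As \<open>y\<close> is a limit of points \<open>u\<close> with
    \<open>\<phi> u \<in> R\<close>, continuity puts some such \<open>\<phi> u\<close> into
    \<open>N\<close>, and one step leads from it to \<open>y\<close>.\<close>
  have closed: "y \<in> R" if "y \<in> U" "y \<in> closure R" for y
  proof -
    have y: "y \<in> closure (\<phi> -` R)" using that dense by (metis closure_closure closure_mono subsetD)
    define N where "N = {x. (x, y) \<in> r}"
    have "\<phi> y \<in> N" using r(3)[of "\<phi> y"] that \<phi>in \<psi>'(4) by (auto simp: N_def)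
    then have "y \<in> \<phi> -` N" by simp
    moreover have "open (\<phi> -` N)" unfolding N_def by (rule open_vimage[OF slice2 \<psi>'(2)])
    ultimately have "\<phi> -` N \<inter> \<phi> -` R \<noteq> {}"
      using y open_Int_closure_eq_empty[of "\<phi> -` N" "\<phi> -` R"] by blast
    then obtain u where "\<phi> u \<in> R" "\<phi> u \<in> N" by blast
    then show ?thesis using step[of "\<phi> u" y] unfolding N_def by blast
  qed
  have "R = U"
  proof -
    have "openin (top_of_set U) R" using oR RU U(1) by (simp add: openin_open_eq)
    moreover have "R = U \<inter> closure R" using closed RU closure_subset[of R] by blast
    then have "closedin (top_of_set U) R" by (metis closed_closure closedin_closed_Int)
    moreover have "R \<noteq> {}"
    proof -
      have "a \<in> R0" by (simp add: R0_def)
      then show ?thesis using r(3)[of a] a by (auto simp: R_def)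
    qed
    ultimately show ?thesis using U(2) by (auto simp: connected_clopen)
  qed
  obtain b where b: "b \<in> G" "b \<notin> Z" using open_avoid_countable[OF G(1,3) Z] by blast
  then have "b \<in> R0" using R0 \<open>R = U\<close> G(2) by blast
  then have "(a, b) \<in> r0\<^sup>*" by (simp add: R0_def)
  then obtain n f where f: "f 0 = a" "f n = b" "\<forall>t<n. (f t, f (Suc t)) \<in> r0" "inj_on f {..n::nat}"
    using rtrancl_injective_chain by metis
  have "0 < n" using f a b by (cases n) auto
  moreover have "f t \<in> U - Z" if "0 < t" "t \<le> n" for t
  proof -
    have "(f (t - 1), f t) \<in> r" "f t \<notin> Z" using f(3)[rule_format, of "t - 1"] that by (auto simp: r0_def)
    then show ?thesis using r(2) by blast
  qed
  ultimately show "\<exists>n f. 0 < n \<and> f 0 = a \<and> f n \<in> G \<and> (\<forall>t<n. (f t, f (Suc t)) \<in> r)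
        \<and> (\<forall>t. 0 < t \<and> t \<le> n \<longrightarrow> f t \<in> U - Z) \<and> inj_on f {..n::nat}"
    using f b by (intro exI[of _ n] exI[of _ f]) (auto simp: r0_def)
qed

text \<open>The chains are built one after the other, the points of the earlier ones being added to
  the forbidden set. Position \<open>0\<close> is exempt from injectivity, as both halves of a new
  orbit start at the same point.\<close>

lemma disjoint_chains:
  assumes "finite J" "countable Z"
    and "\<And>j. j \<in> J \<Longrightarrow> chainable (r j) (U j)"
    and "\<And>j. j \<in> J \<Longrightarrow> a j \<in> U j \<inter> Z \<and> open (G j) \<and> G j \<subseteq> U j \<and> G j \<noteq> {}"
  shows "\<exists>n f. (\<forall>j\<in>J. 0 < n j \<and> f j 0 = a j \<and> f j (n j) \<in> G j \<and> (\<forall>t<n j. (f j t, f j (Suc t)) \<in> r j)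
              \<and> (\<forall>t. 0 < t \<and> t \<le> n j \<longrightarrow> f j t \<in> U j - Z))
           \<and> inj_on (\<lambda>(j, t). f j t) {(j, t). j \<in> J \<and> 0 < t \<and> t \<le> (n j :: nat)}"
  using assms(1,3,4)
proof (induction J rule: finite_induct)
  case empty
  then show ?case by auto
next
  case (insert k J)
  obtain n f where nf: "\<And>j. j \<in> J \<Longrightarrow> 0 < n j \<and> f j 0 = a j \<and> f j (n j) \<in> G j \<and> (\<forall>t<n j. (f j t, f j (Suc t)) \<in> r j)
              \<and> (\<forall>t. 0 < t \<and> t \<le> n j \<longrightarrow> f j t \<in> U j - Z)"
     and inj: "inj_on (\<lambda>(j, t). f j t) {(j, t). j \<in> J \<and> 0 < t \<and> t \<le> (n j :: nat)}"
    using insert.IH insert.prems by (metis (no_types, lifting) insertCI)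
  define Z' where "Z' = Z \<union> (\<Union>j\<in>J. f j ` {..n j})"
  have "countable Z'" using assms(2) insert.hyps(1)
    by (auto simp: Z'_def intro!: countable_UN countable_finite)
  moreover have "a k \<in> U k \<inter> Z'" "open (G k)" "G k \<subseteq> U k" "G k \<noteq> {}" "chainable (r k) (U k)"
    using insert.prems by (auto simp: Z'_def)
  ultimately obtain n' f' where nf': "0 < n'" "f' 0 = a k" "f' n' \<in> G k" "\<And>t. t < n' \<Longrightarrow> (f' t, f' (Suc t)) \<in> r k"
      "\<And>t. 0 < t \<Longrightarrow> t \<le> n' \<Longrightarrow> f' t \<in> U k - Z'" "inj_on f' {..n'::nat}"
    using chainableE[of "r k" "U k" Z' "a k" "G k"] by (metis IntE)
  define N F where "N = n(k := n')" and "F = f(k := f')"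
  have "inj_on (\<lambda>(j, t). F j t) {(j, t). j \<in> insert k J \<and> 0 < t \<and> t \<le> N j}"
  proof -
    have new: "f j t \<noteq> f' s" if "j \<in> J" "t \<le> n j" "0 < s" "s \<le> n'" for j t s
    proof -
      have "f j t \<in> Z'" using that by (auto simp: Z'_def)
      then show ?thesis using nf'(5)[of s] that by auto
    qed
    have "(j, t) = (i, s)" if *: "j \<in> insert k J" "0 < t" "t \<le> N j" "i \<in> insert k J" "0 < s" "s \<le> N i"
      "F j t = F i s" for i j t s
    proof (cases "j = k"; cases "i = k")
      assume "j = k" "i = k"
      then show ?thesis using * nf'(6) by (auto simp: N_def F_def inj_on_def)
    next
      assume "j = k" "i \<noteq> k"
      then show ?thesis using * new[of i s t] by (auto simp: N_def F_def)
    next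
      assume "j \<noteq> k" "i = k"
      then show ?thesis using * new[of j t s] by (auto simp: N_def F_def)
    next
      assume "j \<noteq> k" "i \<noteq> k"
      then have "j \<in> J" "i \<in> J" "t \<le> n j" "s \<le> n i" "f j t = f i s" using * by (auto simp: N_def F_def)
      then show ?thesis using inj_onD[OF inj, of "(j,t)" "(i,s)"] * by auto
    qed
    then show ?thesis unfolding inj_on_def by auto
  qed
  moreover have "0 < N j \<and> F j 0 = a j \<and> F j (N j) \<in> G j \<and> (\<forall>t<N j. (F j t, F j (Suc t)) \<in> r j)
              \<and> (\<forall>t. 0 < t \<and> t \<le> N j \<longrightarrow> F j t \<in> U j - Z)" if "j \<in> insert k J" for j
  proof (cases "j = k")
    case True
    then show ?thesis using nf' by (auto simp: N_def F_def Z'_def)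
  next
    case False
    then have "j \<in> J" using that by simp
    then show ?thesis using nf[OF \<open>j \<in> J\<close>] False by (simp add: N_def F_def)
  qed
  ultimately show ?case by (intro exI[of _ N] exI[of _ F]) blast
qed

section \<open>One stage of the construction\<close>

lemma area_homeo_uniformly_continuous:
  assumes "area_homeo X h g" "bounded X" "e > 0"
  shows "\<exists>d>0. \<forall>x y. dist x y < d \<longrightarrow> dist (h x) (h y) < e"
proof -
  obtain a R where R: "X \<subseteq> cball a R" using assms(2) bounded_subset_cball by blast
  have "uniformly_continuous_on (cball a (R + 1)) h"
    using area_homeoD(1)[OF assms(1)] by (intro compact_uniformly_continuous) (auto intro: continuous_on_subset)
  then obtain d where d: "d > 0"
    "\<And>x y. x \<in> cball a (R + 1) \<Longrightarrow> y \<in> cball a (R + 1) \<Longrightarrow> dist x y < d \<Longrightarrow> dist (h x) (h y) < e"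
    using assms(3) unfolding uniformly_continuous_on_def by (metis dist_commute)
  have "dist (h x) (h y) < e" if xy: "dist x y < min d (min 1 e)" for x y
  proof (cases "x \<in> X \<or> y \<in> X")
    case True
    then have "x \<in> cball a (R + 1)" "y \<in> cball a (R + 1)"
      using R xy dist_triangle[of a x y] dist_triangle[of a y x] by (auto simp: dist_commute subset_eq)
    then show ?thesis using d(2) xy by simp
  next
    case False
    then show ?thesis using area_homeoD(7)[OF assms(1)] xy by simp
  qed
  then show ?thesis using d(1) assms(3) by (intro exI[of _ "min d (min 1 e)"]) auto
qed

text \<open>Ramps of slope \<open>1\<close> and \<open>-1\<close>, vanishing at \<open>r / 4\<close>
  and \<open>2 * \<rho>\<close>, connect the flat line \<open>\<eta> * t\<close> with the line
  \<open>q * t\<close>. As \<open>q \<le> 1/10\<close>, both ramps are above \<open>q * t\<close>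
  between \<open>r / 2\<close> and \<open>3/2 * \<rho>\<close>. All slopes have modulus at most
  \<open>1\<close>, and \<open>min\<close> and \<open>max\<close> keep this Lipschitz bound.\<close>

lemma exists_gauge_profile:
  fixes q \<eta> r \<rho> :: real
  assumes q: "0 < q" "q \<le> 1/10" and \<eta>: "0 < \<eta>" "\<eta> \<le> 1" and r: "0 < r" "r \<le> \<rho>"
  obtains \<theta> :: "real \<Rightarrow> real"
  where "continuous_on UNIV \<theta>"
    "\<And>t t' D. t \<le> t' + D \<Longrightarrow> t' \<le> t + D \<Longrightarrow> \<theta> t \<le> \<theta> t' + D"
    "\<And>t. 0 \<le> t \<Longrightarrow> 0 \<le> \<theta> t" "\<And>t. 0 < t \<Longrightarrow> 0 < \<theta> t" "\<And>t. \<theta> t \<le> q * t"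
    "\<And>t. t \<le> r / 4 \<or> 2 * \<rho> \<le> t \<Longrightarrow> 0 \<le> t \<Longrightarrow> \<theta> t \<le> \<eta> * t"
    "\<And>t. r / 2 \<le> t \<Longrightarrow> t \<le> 3 / 2 * \<rho> \<Longrightarrow> \<theta> t = q * t"
proof
  define \<theta> where "\<theta> t = min (q * t) (max (\<eta> * t) (min (t - r / 4) (2 * \<rho> - t)))" for t
  show "continuous_on UNIV \<theta>" unfolding \<theta>_def by (intro continuous_intros)
  show "\<theta> t \<le> \<theta> t' + D" if D: "t \<le> t' + D" "t' \<le> t + D" for t t' D
  proof -
    have *: "c * t \<le> c * t' + D" if "0 \<le> c" "c \<le> 1" for c
    proof -
      have "c * (t - t') \<le> c * D" using D that by (intro mult_left_mono) auto
      also have "\<dots> \<le> D" using that D mult_right_mono[of c 1 D] by auto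
      finally show ?thesis by (simp add: algebra_simps)
    qed
    show ?thesis using *[of q] *[of \<eta>] D q \<eta> unfolding \<theta>_def by (auto simp: min_def max_def)
  qed
  show "0 \<le> \<theta> t" if "0 \<le> t" for t
    using that q \<eta> by (auto simp: \<theta>_def le_max_iff_disj)
  show "0 < \<theta> t" if "0 < t" for t
    using that q \<eta> by (auto simp: \<theta>_def less_max_iff_disj)
  show "\<theta> t \<le> q * t" for t by (simp add: \<theta>_def)
  show "\<theta> t \<le> \<eta> * t" if "t \<le> r / 4 \<or> 2 * \<rho> \<le> t" "0 \<le> t" for t
  proof -
    have "min (t - r / 4) (2 * \<rho> - t) \<le> 0" using that(1) by auto
    moreover have "0 \<le> \<eta> * t" using that \<eta> by simp
    ultimately have "max (\<eta> * t) (min (t - r / 4) (2 * \<rho> - t)) = \<eta> * t" by linarith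
    then show ?thesis by (simp add: \<theta>_def)
  qed
  show "\<theta> t = q * t" if t: "r / 2 \<le> t" "t \<le> 3 / 2 * \<rho>" for t
  proof -
    have "q * t \<le> 1/10 * t" using q r t by (intro mult_right_mono) auto
    then have "q * t \<le> t - r / 4" "q * t \<le> 2 * \<rho> - t" using t r by linarith+
    then have "q * t \<le> min (t - r / 4) (2 * \<rho> - t)" by simp
    then show ?thesis by (simp add: \<theta>_def min_def le_max_iff_disj)
  qed
qed

text \<open>The factor \<open>1/1000\<close> keeps \<open>96 * tol k\<close>, the slope of the
  gauge, below \<open>1/10\<close>, and \<open>100 * tol k\<close>, the change in one stage, below
  \<open>(1/2) ^ k / 2\<close>.\<close>

definition tol :: "nat \<Rightarrow> real" where "tol k = (1/2) ^ k / 1000"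

lemma tol_pos [simp]: "0 < tol k" by (simp add: tol_def)
lemma tol_le: "tol k \<le> 1/1000" by (simp add: tol_def power_le_one)

text \<open>Backward halves are expressed by \<open>\<psi>\<close> too, not by its inverse: in this
  form a step is read off directly after composing \<open>\<psi>\<close> with a
  perturbation.\<close>

definition step :: "(real \<times> real \<Rightarrow> real \<times> real) \<Rightarrow> bool \<Rightarrow> real \<times> real \<Rightarrow> real \<times> real \<Rightarrow> bool" where
  "step \<psi> s x y \<longleftrightarrow> (if s then \<psi> x = y else \<psi> y = x)"

text \<open>This is what trees and boundary arcs have in common. The radius \<open>\<rho>0\<close>
  serves all \<open>j\<close> at once. The goals \<open>\<tau> j k\<close> return near every point
  of \<open>K j\<close> infinitely often, so an orbit visiting them ever more closely accumulates on
  all of \<open>K j\<close>; they lie in the closure of \<open>X\<close>, hence can be approached.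
  The bound \<open>1\<close> on the distance turns relative errors into absolute ones.\<close>

locale target_system =
  fixes X :: "(real \<times> real) set" and w :: "nat \<Rightarrow> real \<times> real"
    and K :: "nat \<times> bool \<Rightarrow> (real \<times> real) set" and \<tau> :: "nat \<times> bool \<Rightarrow> nat \<Rightarrow> real \<times> real"
    and \<rho>0 :: real
  assumes X: "open X" "connected X" "bounded X"
    and infdist_le_1: "infdist x (- X) \<le> 1"
    and w: "inj w" "w i \<in> X"
    and K: "compact (K j)" "K j \<inter> X = {}"
    and \<rho>0: "0 < \<rho>0" "0 < \<rho> \<Longrightarrow> \<rho> \<le> \<rho>0 \<Longrightarrow> connected (nbhd (K j) \<rho> \<inter> X)"
    and \<tau>: "\<tau> j k \<in> K j" "\<tau> j k \<in> closure X"
    and \<tau>_dense: "y \<in> K j \<Longrightarrow> 0 < e \<Longrightarrow> \<exists>k\<ge>N. dist (\<tau> j k) y < e"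
begin

abbreviation d :: "real \<times> real \<Rightarrow> real" where "d x \<equiv> infdist x (- X)"

text \<open>An index \<open>j = (i, b)\<close> stands for the forward (\<open>b = True\<close>) or backward (\<open>b = False\<close>) half of the
  orbit of \<open>w i\<close>; \<open>P j t\<close> is the point reached after \<open>t \<le> L j\<close> steps of that half. For \<open>k \<le> i\<close> the
  orbit of \<open>w i\<close> has not been started before stage \<open>k\<close>, whence \<open>L j = 0\<close>.\<close>

definition admissible ::
  "nat \<Rightarrow> (pt \<Rightarrow> pt) \<Rightarrow> (pt \<Rightarrow> pt) \<Rightarrow> real \<Rightarrow> (nat \<times> bool \<Rightarrow> nat) \<Rightarrow> (nat \<times> bool \<Rightarrow> nat \<Rightarrow> pt) \<Rightarrow> bool" where
  "admissible k \<psi> \<phi> \<rho> L P \<longleftrightarrow> area_homeo X \<psi> \<phi> \<and> (\<exists>r>0. \<forall>x. d x < r \<longrightarrow> \<psi> x = x)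
    \<and> 0 < \<rho> \<and> \<rho> \<le> \<rho>0 \<and> \<rho> \<le> 1 / real (Suc k)
    \<and> (\<forall>x. d x < 3 * \<rho> \<longrightarrow> dist (\<psi> x) x \<le> tol k * d x \<and> dist (\<phi> x) x \<le> tol k * d x)
    \<and> (\<forall>j. P j 0 = w (fst j)) \<and> (\<forall>j. k \<le> fst j \<longrightarrow> L j = 0)
    \<and> (\<forall>j. \<forall>t<L j. step \<psi> (snd j) (P j t) (P j (Suc t)))
    \<and> (\<forall>j. fst j < k \<longrightarrow> P j (L j) \<in> nbhd (K j) \<rho>)
    \<and> (\<forall>j t. t \<le> L j \<longrightarrow> P j t \<in> X)
    \<and> inj_on (\<lambda>(j, t). P j t) {(j, t). 0 < t \<and> t \<le> L j}
    \<and> (\<forall>j t. 0 < t \<and> t \<le> L j \<longrightarrow> P j t \<notin> range w)"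

text \<open>Confinement to \<open>nbhd (K j) \<rho>\<close> concerns \<open>fst j < k\<close> only:
  the orbit of \<open>w k\<close> starts at this stage and has to cross \<open>X\<close> first.
  Confinement will give one inclusion for the limit set, closeness of the endpoints to the goals the
  other.\<close>

definition extends ::
  "nat \<Rightarrow> (pt \<Rightarrow> pt) \<Rightarrow> (pt \<Rightarrow> pt) \<Rightarrow> real \<Rightarrow> (nat \<times> bool \<Rightarrow> nat) \<Rightarrow> (nat \<times> bool \<Rightarrow> nat \<Rightarrow> pt) \<Rightarrow> (pt \<Rightarrow> pt) \<Rightarrow> (pt \<Rightarrow> pt) \<Rightarrow> (nat \<times> bool \<Rightarrow> nat) \<Rightarrow> (nat \<times> bool \<Rightarrow> nat \<Rightarrow> pt) \<Rightarrow> bool" where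
  "extends k \<psi> \<phi> \<rho> L P \<psi>' \<phi>' L' P' \<longleftrightarrow> (\<forall>x. dist (\<psi>' x) (\<psi> x) \<le> 100 * tol k) \<and> (\<forall>x. dist (\<phi>' x) (\<phi> x) \<le> 100 * tol k)
    \<and> (\<forall>j. L j \<le> L' j) \<and> (\<forall>j. fst j \<le> k \<longrightarrow> L j < L' j)
    \<and> (\<forall>j t. t \<le> L j \<longrightarrow> P' j t = P j t)
    \<and> (\<forall>j t. fst j < k \<longrightarrow> L j \<le> t \<longrightarrow> t \<le> L' j \<longrightarrow> P' j t \<in> nbhd (K j) \<rho>)
    \<and> (\<forall>j. fst j \<le> k \<longrightarrow> dist (P' j (L' j)) (\<tau> j k) < 1 / real (Suc k))"

section \<open>Distance to the complement of \<open>X\<close> and the gauge\<close>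

lemma d_pos: "0 < d x \<longleftrightarrow> x \<in> X"
proof -
  \<comment> \<open>\<open>infdist\<close> to the empty set is \<open>0\<close> by
    convention.\<close>
  have "- X \<noteq> {}"
  proof
    assume "- X = {}"
    then have "X = UNIV" by blast
    then show False using X(3) not_bounded_UNIV by metis
  qed
  moreover have "closed (- X)" using X(1) by auto
  ultimately show ?thesis
    using in_closed_iff_infdist_zero[of "- X" x] infdist_nonneg[of x "- X"] by auto
qed

lemma d_lip: "d x \<le> d y + dist x y"
  by (rule infdist_triangle)

lemma d_nbhd: "x \<in> nbhd (K j) \<rho> \<Longrightarrow> d x < \<rho>"
proof -
  assume "x \<in> nbhd (K j) \<rho>"
  then obtain y where "y \<in> K j" "dist y x < \<rho>" by (auto simp: nbhd_def)
  moreover have "y \<in> - X" using K(2)[of j] \<open>y \<in> K j\<close> by blast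
  ultimately show ?thesis using infdist_le[of y "- X" x] by (simp add: dist_commute)
qed

lemma area_homeo_fix_inv: "area_homeo S h g \<Longrightarrow> h x = x \<Longrightarrow> g x = x"
  using area_homeoD(3)[of S h g x] by simp

text \<open>The gauge \<open>\<delta>\<close> bounds the perturbation \<open>h\<close>. It must dominate the jumps of \<open>\<psi>\<close> close to the complement
  of \<open>X\<close>, but very close to it, where \<open>\<psi>\<close> is the identity, and far away from it, it can be as small as
  one likes; this leaves room for the improved estimates at the next stage.\<close>

lemma exists_gauge:
  assumes "area_homeo X \<psi> \<phi>" "0 < r" "\<And>x. d x < r \<Longrightarrow> \<psi> x = x" "r \<le> \<rho>"
    and near: "\<And>x. d x < 3 * \<rho> \<Longrightarrow> dist (\<psi> x) x \<le> tol k * d x \<and> dist (\<phi> x) x \<le> tol k * d x"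
  shows "\<exists>\<delta>. continuous_on UNIV \<delta> \<and> (\<forall>x y. \<delta> x \<le> \<delta> y + dist x y) \<and> (\<forall>x. \<delta> x \<le> d x) \<and> (\<forall>x. 0 \<le> \<delta> x)
     \<and> (\<forall>x\<in>X. 0 < \<delta> x)
     \<and> (\<forall>x\<in>X. d x < \<rho> \<longrightarrow> dist (\<psi> x) x < \<delta> (\<psi> x) / 32)
     \<and> (\<forall>h g. area_homeo X h g \<longrightarrow> (\<forall>x. dist (h x) x \<le> \<delta> x) \<longrightarrow>
          (\<forall>x. dist (h (\<psi> x)) (\<psi> x) \<le> 100 * tol k) \<and> (\<forall>x. dist (\<phi> (g x)) (\<phi> x) \<le> 100 * tol k)
          \<and> (\<forall>x. d x < r / 8 \<longrightarrow> dist (h (\<psi> x)) x \<le> tol (Suc k) * d x \<and> dist (\<phi> (g x)) x \<le> tol (Suc k) * d x))"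
proof -
  \<comment> \<open>Controls the effect of \<open>g\<close> on \<open>\<phi>\<close> away from the
    complement, where no relative estimate for \<open>\<phi>\<close> is available.\<close>
  obtain \<eta>0 where \<eta>0: "\<eta>0 > 0" "\<And>x y. dist x y < \<eta>0 \<Longrightarrow> dist (\<phi> x) (\<phi> y) < tol k"
    using area_homeo_uniformly_continuous[OF area_homeo_sym[OF assms(1)] X(3) tol_pos] by blast
  define \<eta> where "\<eta> = min (tol (Suc k) / 2) (\<eta>0 / 2)"
  have \<eta>: "0 < \<eta>" "\<eta> \<le> tol (Suc k) / 2" "\<eta> < \<eta>0" "\<eta> \<le> 1"
    using \<eta>0(1) tol_le[of "Suc k"] by (auto simp: \<eta>_def min_def)
  \<comment> \<open>\<open>96 = 3 * 32\<close>: then \<open>\<delta> (\<psi> x) / 32\<close> is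
    \<open>3 * tol k * d (\<psi> x)\<close>, and since \<open>d (\<psi> x)\<close> is at least
    \<open>d x / 2\<close>, this exceeds the jump \<open>tol k * d x\<close>.\<close>
  define q where "q = 96 * tol k"
  have q: "0 < q" "q \<le> 1/10" using tol_le[of k] by (auto simp: q_def)
  obtain \<theta> :: "real \<Rightarrow> real" where \<theta>: "continuous_on UNIV \<theta>"
    "\<And>t t' D. t \<le> t' + D \<Longrightarrow> t' \<le> t + D \<Longrightarrow> \<theta> t \<le> \<theta> t' + D"
    "\<And>t. 0 \<le> t \<Longrightarrow> 0 \<le> \<theta> t" "\<And>t. 0 < t \<Longrightarrow> 0 < \<theta> t" "\<And>t. \<theta> t \<le> q * t"
    "\<And>t. t \<le> r / 4 \<or> 2 * \<rho> \<le> t \<Longrightarrow> 0 \<le> t \<Longrightarrow> \<theta> t \<le> \<eta> * t"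
    "\<And>t. r / 2 \<le> t \<Longrightarrow> t \<le> 3 / 2 * \<rho> \<Longrightarrow> \<theta> t = q * t"
    by (rule exists_gauge_profile[OF q \<eta>(1,4) assms(2,4)]) (rule that)
  define \<delta> where "\<delta> x = \<theta> (d x)" for x
  have d0: "0 \<le> d x" for x by (rule infdist_nonneg)
  have qd: "q * d x \<le> d x / 10" for x using mult_right_mono[OF q(2) d0[of x]] by simp
  have sd: "tol k * d x \<le> d x / 1000" for x using mult_right_mono[OF tol_le d0[of x], of k] by simp
  have qd1: "q * d x \<le> q" for x using mult_left_mono[OF infdist_le_1[of x], of q] q by simp
  have sd1: "tol k * d x \<le> tol k" for x using mult_left_mono[OF infdist_le_1[of x], of "tol k"] by (simp add: less_imp_le)
  have \<delta>q: "\<delta> x \<le> q * d x" for x by (simp add: \<delta>_def \<theta>(5))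
  have \<delta>d: "\<delta> x \<le> d x / 10" for x using \<delta>q[of x] qd[of x] by linarith
  have \<delta>\<eta>: "\<delta> x \<le> \<eta> * d x" if "d x \<le> r / 4 \<or> 2 * \<rho> \<le> d x" for x
    using \<theta>(6)[OF that d0] by (simp add: \<delta>_def)
  show ?thesis
  proof (intro exI[of _ \<delta>] conjI allI ballI impI)
    show "continuous_on UNIV \<delta>" unfolding \<delta>_def
      by (intro continuous_on_compose2[OF \<theta>(1)] continuous_intros) auto
    show "\<delta> x \<le> \<delta> y + dist x y" for x y
      unfolding \<delta>_def using d_lip[of x y] d_lip[of y x] by (intro \<theta>(2)) (auto simp: dist_commute)
    show "\<delta> x \<le> d x" for x using \<delta>d[of x] d0[of x] by linarith
    show "0 \<le> \<delta> x" for x unfolding \<delta>_def using d0 by (rule \<theta>(3))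
    show "0 < \<delta> x" if "x \<in> X" for x unfolding \<delta>_def using that d_pos by (intro \<theta>(4)) auto
    show "dist (\<psi> x) x < \<delta> (\<psi> x) / 32" if x: "x \<in> X" "d x < \<rho>" for x
    \<comment> \<open>Very near the complement \<open>\<delta>\<close> may be too small to dominate
      a jump, but there \<open>\<psi> x = x\<close>.\<close>
    proof (cases "d x < r")
      case True
      then show ?thesis using assms(3) x(1) d_pos \<theta>(4) by (auto simp: \<delta>_def)
    next
      case False
      have dx: "0 < d x" using x d_pos by blast
      have 1: "dist (\<psi> x) x \<le> tol k * d x" using near[of x] x dx by simp
      have 2: "d x \<le> d (\<psi> x) + dist (\<psi> x) x" "d (\<psi> x) \<le> d x + dist (\<psi> x) x"
        using d_lip[of x "\<psi> x"] d_lip[of "\<psi> x" x] by (auto simp: dist_commute)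
      have b: "r / 2 \<le> d (\<psi> x)" "d (\<psi> x) \<le> 3 / 2 * \<rho>" "d x / 2 \<le> d (\<psi> x)"
        using 1 2 sd[of x] False x dx by linarith+
      have "\<delta> (\<psi> x) = 96 * (tol k * d (\<psi> x))" using \<theta>(7)[OF b(1,2)] by (simp add: \<delta>_def q_def)
      moreover have "tol k * (d x / 2) \<le> tol k * d (\<psi> x)" using b(3) by (intro mult_left_mono) (auto simp: less_imp_le)
      moreover have "0 < tol k * d x" using dx by simp
      ultimately show ?thesis using 1 by linarith
    qed
    fix h g assume h: "area_homeo X h g" and hd: "\<forall>x. dist (h x) x \<le> \<delta> x"
    have gd: "dist x (g x) \<le> \<delta> (g x)" for x using hd[rule_format, of "g x"] area_homeoD(4)[OF h] by simp
    show "dist (h (\<psi> x)) (\<psi> x) \<le> 100 * tol k" for x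
      using hd[rule_format, of "\<psi> x"] \<delta>q[of "\<psi> x"] qd1[of "\<psi> x"] tol_pos[of k] unfolding q_def by linarith
    show "dist (\<phi> (g x)) (\<phi> x) \<le> 100 * tol k" for x
    proof (cases "d (g x) < 2 * \<rho>")
      case True
      \<comment> \<open>\<open>x\<close> may lie slightly further out than \<open>g x\<close>, so
        the estimate for \<open>\<phi>\<close> must reach beyond \<open>2 * \<rho>\<close>; hence
        the factor \<open>3\<close> in \<open>admissible\<close>. The three displacements add up to
        \<open>1 + 96 + 1\<close> times \<open>tol k\<close>.\<close>
      have "d x \<le> d (g x) + dist x (g x)" by (rule d_lip)
      then have "d x < 3 * \<rho>" using gd[of x] \<delta>d[of "g x"] True assms(2,4) by linarith
      then have "dist (\<phi> x) x \<le> tol k" using near[of x] sd1[of x] by linarith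
      moreover have "dist (\<phi> (g x)) (g x) \<le> tol k"
        using near[of "g x"] sd1[of "g x"] True assms(2,4) by linarith
      moreover have "dist x (g x) \<le> 96 * tol k"
        using gd[of x] \<delta>q[of "g x"] qd1[of "g x"] unfolding q_def by linarith
      moreover have "dist (\<phi> (g x)) (\<phi> x) \<le> dist (\<phi> (g x)) (g x) + dist x (g x) + dist (\<phi> x) x"
        using dist_triangle[of "\<phi> (g x)" "\<phi> x" "g x"] dist_triangle[of "g x" "\<phi> x" x] by (simp add: dist_commute)
      ultimately show ?thesis using tol_pos[of k] by linarith
    next
      case False
      then have "dist x (g x) \<le> \<eta> * d (g x)" using gd[of x] \<delta>\<eta>[of "g x"] by linarith
      also have "\<dots> \<le> \<eta>" using mult_left_mono[OF infdist_le_1[of "g x"], of \<eta>] \<eta> by simp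
      finally have "dist (g x) x < \<eta>0" using \<eta> by (simp add: dist_commute)
      then show ?thesis using \<eta>0(2)[of "g x" x] tol_pos[of k] by linarith
    qed
    fix x assume x: "d x < r / 8"
    have \<psi>x: "\<psi> x = x" using assms(3)[of x] x assms(2) by simp
    have 1: "\<eta> * t \<le> tol (Suc k) / 2 * t" if "0 \<le> t" for t
      using \<eta>(2) that by (rule mult_right_mono)
    have "d x \<le> r / 4" using x assms(2) by linarith
    then have "dist (h x) x \<le> \<eta> * d x" using order_trans[OF hd[rule_format] \<delta>\<eta>] by blast
    also have "\<dots> \<le> tol (Suc k) / 2 * d x" using d0 by (rule 1)
    also have "\<dots> \<le> tol (Suc k) * d x" using d0[of x] tol_pos[of "Suc k"] by (intro mult_right_mono) linarith+
    finally show "dist (h (\<psi> x)) x \<le> tol (Suc k) * d x" using \<psi>x by simp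
    \<comment> \<open>For the inverse the error is measured at \<open>g x\<close>, where
      \<open>d\<close> may be twice as large: hence the half in the bound for \<open>\<eta>\<close>
      and the passage from \<open>r / 8\<close> to \<open>r / 4\<close>.\<close>
    have gx: "d (g x) \<le> d x + dist x (g x)" using d_lip[of "g x" x] by (simp add: dist_commute)
    then have gx2: "d (g x) \<le> 2 * d x" "d (g x) < r / 4"
      using gd[of x] \<delta>d[of "g x"] d0[of "g x"] x by linarith+
    then have "\<psi> (g x) = g x" using assms(2,3) by simp
    then have "\<phi> (g x) = g x" by (rule area_homeo_fix_inv[OF assms(1)])
    then have "dist (\<phi> (g x)) x = dist x (g x)" by (simp add: dist_commute)
    also have "\<dots> \<le> \<eta> * d (g x)" using gd[of x] \<delta>\<eta>[of "g x"] gx2 by linarith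
    also have "\<dots> \<le> tol (Suc k) / 2 * d (g x)" using d0 by (rule 1)
    also have "\<dots> \<le> tol (Suc k) / 2 * (2 * d x)" using gx2 by (intro mult_left_mono) (auto simp: less_imp_le)
    finally show "dist (\<phi> (g x)) x \<le> tol (Suc k) * d x" by simp
  qed
qed

text \<open>On \<open>X\<close> the relation contains the graph of \<open>\<psi>\<close>, its
  converse that of \<open>\<phi>\<close>, and both maps preserve area. The collar need not be
  invariant under \<open>\<psi>\<close>, but there the relation contains the diagonal by
  \<open>near\<close>, so the chain lemma is applied to the identity; this keeps the chains inside
  the collar.\<close>

lemma chainable_steps:
  assumes \<psi>: "area_homeo X \<psi> \<phi>" and \<delta>: "continuous_on UNIV \<delta>" "\<And>x. x \<in> X \<Longrightarrow> 0 < \<delta> x"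
    and near: "\<And>x. x \<in> X \<Longrightarrow> d x < \<rho> \<Longrightarrow> dist (\<psi> x) x < \<delta> (\<psi> x) / 32"
    and \<rho>: "0 < \<rho>" "\<rho> \<le> \<rho>0"
    and r: "r = {(x, y). x \<in> X \<and> y \<in> X \<and> dist (\<psi> x) y < \<delta> (\<psi> x) / 32}"
  shows "chainable r X" "chainable (r\<inverse>) X"
    "chainable r (nbhd (K j) \<rho> \<inter> X)" "chainable (r\<inverse>) (nbhd (K j) \<rho> \<inter> X)"
proof -
  note cont = area_homeoD(1)[OF \<psi>]
  have "r = (X \<times> X) \<inter> {z. dist (\<psi> (fst z)) (snd z) < \<delta> (\<psi> (fst z)) / 32}"
    by (auto simp: r)
  moreover have "open {z. dist (\<psi> (fst z)) (snd z) < \<delta> (\<psi> (fst z)) / 32}"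
    by (intro open_Collect_less continuous_intros continuous_on_compose2[OF cont]
        continuous_on_compose2[OF \<delta>(1) continuous_on_compose2[OF cont]]) auto
  ultimately have ro: "open r" using X(1) by (simp add: open_Int open_Times)
  have inv: "open (s\<inverse>)" if "open s" for s :: "((real \<times> real) \<times> (real \<times> real)) set"
  proof -
    have "s\<inverse> = (\<lambda>z. (snd z, fst z)) -` s" by auto
    then show ?thesis using that by (auto intro!: open_vimage continuous_intros)
  qed
  have \<psi>X: "\<psi> x \<in> X \<longleftrightarrow> x \<in> X" "\<phi> x \<in> X \<longleftrightarrow> x \<in> X" for x
    using area_homeo_in[OF \<psi>] area_homeo_in[OF area_homeo_sym[OF \<psi>]] by auto
  have graph: "(x, \<psi> x) \<in> r" if "x \<in> X" for x
    using that \<psi>X \<delta>(2)[of "\<psi> x"] by (simp add: r)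
  have rsub: "r \<subseteq> X \<times> X" by (auto simp: r)
  show "chainable r X"
    by (rule chainable_area_preserving[OF X \<psi> ro rsub graph])
  show "chainable (r\<inverse>) X"
  proof (rule chainable_area_preserving[OF X area_homeo_sym[OF \<psi>] inv[OF ro]])
    show "(x, \<phi> x) \<in> r\<inverse>" if "x \<in> X" for x
      using graph[of "\<phi> x"] that \<psi>X area_homeoD(4)[OF \<psi>] by simp
  qed (use rsub in blast)
  define U where "U = nbhd (K j) \<rho> \<inter> X"
  have U: "open U" "connected U" "bounded U"
    using \<rho> \<rho>0 X by (auto simp: U_def open_nbhd intro: bounded_subset)
  have id: "(x, x) \<in> r" if "x \<in> U" for x
    using that near[of x] d_nbhd[of x j \<rho>] by (simp add: U_def r)
  have "open (r \<inter> U \<times> U)" using ro U by (simp add: open_Int open_Times)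
  then have c: "chainable (r \<inter> U \<times> U) U" "chainable ((r \<inter> U \<times> U)\<inverse>) U"
    using id by (intro chainable_area_preserving[OF U area_homeo_id] inv; blast)+
  show "chainable r (nbhd (K j) \<rho> \<inter> X)" "chainable (r\<inverse>) (nbhd (K j) \<rho> \<inter> X)"
    using chainable_mono[OF c(1), of r] chainable_mono[OF c(2), of "r\<inverse>"] by (auto simp: U_def)
qed

text \<open>Chains prolong the half orbits, inside the collar where an orbit has arrived and through
  \<open>X\<close> for the newly started \<open>w k\<close>; backward halves use the converse
  relation. The bound \<open>\<delta> / 32\<close> on the jumps is the one under which
  \<open>area_homeo_realize\<close> can close them.\<close>

lemma extend_orbits:
  assumes g: "admissible k \<psi> \<phi> \<rho> L P" and \<delta>: "continuous_on UNIV \<delta>" "\<And>x. x \<in> X \<Longrightarrow> 0 < \<delta> x"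
    and near: "\<And>x. x \<in> X \<Longrightarrow> d x < \<rho> \<Longrightarrow> dist (\<psi> x) x < \<delta> (\<psi> x) / 32"
    and \<rho>': "0 < \<rho>'" "\<rho>' \<le> \<rho>"
  shows "\<exists>L' P'. (\<forall>j. L j \<le> L' j) \<and> (\<forall>j. fst j \<le> k \<longrightarrow> L j < L' j) \<and> (\<forall>j. Suc k \<le> fst j \<longrightarrow> L' j = 0)
    \<and> (\<forall>j t. t \<le> L j \<longrightarrow> P' j t = P j t)
    \<and> (\<forall>j t. fst j < k \<longrightarrow> L j \<le> t \<longrightarrow> t \<le> L' j \<longrightarrow> P' j t \<in> nbhd (K j) \<rho>)
    \<and> (\<forall>j. fst j \<le> k \<longrightarrow> dist (P' j (L' j)) (\<tau> j k) < \<rho>')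
    \<and> (\<forall>j t. t \<le> L' j \<longrightarrow> P' j t \<in> X)
    \<and> inj_on (\<lambda>(j, t). P' j t) {(j, t). 0 < t \<and> t \<le> L' j}
    \<and> (\<forall>j t. 0 < t \<and> t \<le> L' j \<longrightarrow> P' j t \<notin> range w)
    \<and> (\<forall>j t. t < L' j \<longrightarrow> (if snd j then dist (\<psi> (P' j t)) (P' j (Suc t)) < \<delta> (\<psi> (P' j t)) / 32
                               else dist (\<psi> (P' j (Suc t))) (P' j t) < \<delta> (\<psi> (P' j (Suc t))) / 32))"
proof -
  have \<psi>: "area_homeo X \<psi> \<phi>" and \<rho>: "0 < \<rho>" "\<rho> \<le> \<rho>0" and P0: "\<And>j. P j 0 = w (fst j)"
    and L0: "\<And>j. k \<le> fst j \<Longrightarrow> L j = 0"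
    and st: "\<And>j t. t < L j \<Longrightarrow> step \<psi> (snd j) (P j t) (P j (Suc t))"
    and ends: "\<And>j. fst j < k \<Longrightarrow> P j (L j) \<in> nbhd (K j) \<rho>"
    and PX: "\<And>j t. t \<le> L j \<Longrightarrow> P j t \<in> X"
    and inj: "inj_on (\<lambda>(j, t). P j t) {(j, t). 0 < t \<and> t \<le> L j}"
    and Pw: "\<And>j t. 0 < t \<Longrightarrow> t \<le> L j \<Longrightarrow> P j t \<notin> range w"
    using g unfolding admissible_def by blast+
  define r where "r = {(x, y). x \<in> X \<and> y \<in> X \<and> dist (\<psi> x) y < \<delta> (\<psi> x) / 32}"
  have ch: "chainable r X" "chainable (r\<inverse>) X"
    "chainable r (nbhd (K j) \<rho> \<inter> X)" "chainable (r\<inverse>) (nbhd (K j) \<rho> \<inter> X)" for j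
    by (rule chainable_steps[OF \<psi> \<delta> near \<rho> r_def]; assumption)+
  define rr where "rr j = (if snd j then r else r\<inverse>)" for j :: "nat \<times> bool"
  define U where "U j = (if fst j < k then nbhd (K j) \<rho> \<inter> X else X)" for j
  define J where "J = {..k} \<times> (UNIV :: bool set)"
  \<comment> \<open>All \<open>w i\<close> are forbidden, also those whose orbits start at a later
    stage: otherwise prescribed orbits could collide.\<close>
  define Z where "Z = range w \<union> (\<Union>j. P j ` {..L j})"
  define G where "G j = X \<inter> ball (\<tau> j k) \<rho>'" for j
  have cZ: "countable Z" by (auto simp: Z_def)
  have fJ: "finite J" by (simp add: J_def)
  have cU: "chainable (rr j) (U j)" for j
    using ch by (simp add: rr_def U_def)
  have aG: "P j (L j) \<in> U j \<inter> Z \<and> open (G j) \<and> G j \<subseteq> U j \<and> G j \<noteq> {}" if "j \<in> J" for j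
  proof (intro conjI)
    have "P j (L j) \<in> Z" unfolding Z_def by blast
    then show "P j (L j) \<in> U j \<inter> Z" using ends[of j] PX[of "L j" j] by (simp add: U_def)
    show "open (G j)" using X(1) by (auto simp: G_def)
    have "ball (\<tau> j k) \<rho>' \<subseteq> ball (\<tau> j k) \<rho>" using \<rho>' by auto
    also have "\<dots> \<subseteq> nbhd (K j) \<rho>" unfolding nbhd_def using \<tau>(1)[of j k] by blast
    finally have "ball (\<tau> j k) \<rho>' \<subseteq> nbhd (K j) \<rho>" .
    then show "G j \<subseteq> U j" by (auto simp: G_def U_def)
    have "\<tau> j k \<in> ball (\<tau> j k) \<rho>'" using \<rho>' by simp
    then have "ball (\<tau> j k) \<rho>' \<inter> X \<noteq> {}"
      using \<tau>(2)[of j k] open_Int_closure_eq_empty[of "ball (\<tau> j k) \<rho>'" X] by blast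
    then show "G j \<noteq> {}" by (simp add: G_def Int_commute)
  qed
  have "\<exists>n f. (\<forall>j\<in>J. 0 < n j \<and> f j 0 = P j (L j) \<and> f j (n j) \<in> G j \<and> (\<forall>t<n j. (f j t, f j (Suc t)) \<in> rr j)
              \<and> (\<forall>t. 0 < t \<and> t \<le> n j \<longrightarrow> f j t \<in> U j - Z))
           \<and> inj_on (\<lambda>(j, t). f j t) {(j, t). j \<in> J \<and> 0 < t \<and> t \<le> (n j :: nat)}"
    by (rule disjoint_chains[OF fJ cZ cU aG])
  then obtain n f where F: "(\<forall>j\<in>J. 0 < n j \<and> f j 0 = P j (L j) \<and> f j (n j) \<in> G j \<and> (\<forall>t<n j. (f j t, f j (Suc t)) \<in> rr j)
              \<and> (\<forall>t. 0 < t \<and> t \<le> n j \<longrightarrow> f j t \<in> U j - Z))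
           \<and> inj_on (\<lambda>(j, t). f j t) {(j, t). j \<in> J \<and> 0 < t \<and> t \<le> (n j :: nat)}"
    by (elim exE) (rule that)
  note nf = F[THEN conjunct1, THEN bspec] and finj = F[THEN conjunct2]
  have J: "j \<in> J \<longleftrightarrow> fst j \<le> k" for j by (cases j) (auto simp: J_def)
  define L' where "L' j = (if j \<in> J then L j + n j else L j)" for j
  define P' where "P' j t = (if j \<in> J \<and> L j < t then f j (t - L j) else P j t)" for j t
  have old: "P' j t = P j t" if "t \<le> L j" for j t using that by (simp add: P'_def)
  \<comment> \<open>Valid already at \<open>t = L j\<close>, since the chain starts at the old
    endpoint; so the step across the seam is a chain step.\<close>
  have new: "P' j t = f j (t - L j)" if "j \<in> J" "L j \<le> t" for j t
    using that nf[OF that(1)] by (cases "L j = t") (auto simp: P'_def)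
  have newU: "f j t \<in> U j" if "j \<in> J" "t \<le> n j" for j t
  proof (cases "t = 0")
    case True
    then show ?thesis using nf[OF that(1)] ends PX by (auto simp: U_def)
  qed (use nf[OF that(1)] that in auto)
  have newZ: "f j t \<notin> Z" if "j \<in> J" "0 < t" "t \<le> n j" for j t
    using nf[OF that(1)] that by auto
  have UX: "U j \<subseteq> X" for j by (auto simp: U_def)
  show ?thesis
  proof (intro exI[of _ L'] exI[of _ P'] conjI allI impI)
    show "L j \<le> L' j" for j by (simp add: L'_def)
    show "L j < L' j" if "fst j \<le> k" for j using that J nf by (simp add: L'_def)
    show "L' j = 0" if "Suc k \<le> fst j" for j using that J L0 by (simp add: L'_def)
    show "P' j t = P j t" if "t \<le> L j" for j t using that by (rule old)
    show "P' j t \<in> nbhd (K j) \<rho>" if "fst j < k" "L j \<le> t" "t \<le> L' j" for j t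
      using that newU[of j "t - L j"] new[of j t] J[of j] by (auto simp: L'_def U_def)
    show "dist (P' j (L' j)) (\<tau> j k) < \<rho>'" if "fst j \<le> k" for j
      using that nf[of j] new[of j "L' j"] J[of j] by (auto simp: L'_def G_def dist_commute)
    show "P' j t \<in> X" if "t \<le> L' j" for j t
    proof (cases "t \<le> L j")
      case True
      then show ?thesis using old PX by simp
    next
      case False
      then have "j \<in> J" using that by (auto simp: L'_def split: if_splits)
      then show ?thesis using False that newU[of j "t - L j"] new[of j t] UX[of j] by (auto simp: L'_def)
    qed
    have P'cases: "(t \<le> L j \<and> P' j t = P j t \<and> P j t \<notin> range w \<and> P j t \<in> Z)
       \<or> (j \<in> J \<and> L j < t \<and> t - L j \<le> n j \<and> P' j t = f j (t - L j) \<and> P' j t \<notin> Z)"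
      if "0 < t" "t \<le> L' j" for j t
    proof (cases "t \<le> L j")
      case True
      then have "P j t \<in> Z" unfolding Z_def by blast
      then show ?thesis using old[OF True] Pw[OF that(1) True] True by simp
    next
      case False
      then have "j \<in> J" using that by (auto simp: L'_def split: if_splits)
      then show ?thesis using False that newZ[of j "t - L j"] new[of j t] by (auto simp: L'_def)
    qed
    show "P' j t \<notin> range w" if "0 < t \<and> t \<le> L' j" for j t
      using P'cases[of t j] that by (auto simp: Z_def)
    show "inj_on (\<lambda>(j, t). P' j t) {(j, t). 0 < t \<and> t \<le> L' j}"
    proof -
      have inj0: "(j, t) = (i, s)" if *: "0 < t" "t \<le> L' j" "0 < s" "s \<le> L' i" "P' j t = P' i s" for i j t s
        using P'cases[OF *(1,2)] P'cases[OF *(3,4)]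
      proof (elim disjE)
        assume a: "t \<le> L j \<and> P' j t = P j t \<and> P j t \<notin> range w \<and> P j t \<in> Z"
          "s \<le> L i \<and> P' i s = P i s \<and> P i s \<notin> range w \<and> P i s \<in> Z"
        then have "P j t = P i s" using *(5) by simp
        then show ?thesis using inj_onD[OF inj, of "(j,t)" "(i,s)"] *(1,3) a by simp
      next
        assume a: "j \<in> J \<and> L j < t \<and> t - L j \<le> n j \<and> P' j t = f j (t - L j) \<and> P' j t \<notin> Z"
          "i \<in> J \<and> L i < s \<and> s - L i \<le> n i \<and> P' i s = f i (s - L i) \<and> P' i s \<notin> Z"
        then have feq: "(\<lambda>(j, t). f j t) (j, t - L j) = (\<lambda>(j, t). f j t) (i, s - L i)" using *(5) by simp
        have "(j, t - L j) = (i, s - L i)"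
          by (rule inj_onD[OF finj feq]) (use a in simp_all)
        then have "j = i" "t - L j = s - L i" by blast+
        moreover have "L j < t" "L i < s" using a by blast+
        ultimately have "j = i" "t = s" by auto
        then show ?thesis by simp
      qed (use * in auto)
      show ?thesis
      proof (rule inj_onI)
        fix a b assume ab: "a \<in> {(j, t). 0 < t \<and> t \<le> L' j}" "b \<in> {(j, t). 0 < t \<and> t \<le> L' j}"
          "(\<lambda>(j, t). P' j t) a = (\<lambda>(j, t). P' j t) b"
        obtain j t i s where e: "a = (j, t)" "b = (i, s)" by fastforce
        then show "a = b" using inj0[of t j s i] ab by simp
      qed
    qed
    show "if snd j then dist (\<psi> (P' j t)) (P' j (Suc t)) < \<delta> (\<psi> (P' j t)) / 32
                               else dist (\<psi> (P' j (Suc t))) (P' j t) < \<delta> (\<psi> (P' j (Suc t))) / 32"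
      if t: "t < L' j" for j t
    proof (cases "t < L j")
      case True
      then have "step \<psi> (snd j) (P' j t) (P' j (Suc t))" "P' j t \<in> X" "P' j (Suc t) \<in> X"
        using st[OF True] old PX by auto
      then show ?thesis using \<delta>(2) by (auto simp: step_def)
    next
      case False
      then have j: "j \<in> J" using t by (auto simp: L'_def split: if_splits)
      then have "(f j (t - L j), f j (Suc (t - L j))) \<in> rr j"
        using nf[OF j] t False by (auto simp: L'_def)
      then have "(P' j t, P' j (Suc t)) \<in> rr j"
        using new[OF j, of t] new[OF j, of "Suc t"] False by (simp add: Suc_diff_le)
      then show ?thesis by (simp add: rr_def r_def split: if_splits)
    qed
  qed
qed

text \<open>Once the gauge \<open>\<delta>\<close> is fixed, the orbits are prolonged with jumps
  small relative to it; a perturbation \<open>h\<close> bounded by \<open>\<delta>\<close> then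
  closes all jumps at once, and \<open>h \<circ> \<psi>\<close> is the next map.\<close>

lemma next_stage:
  assumes g: "admissible k \<psi> \<phi> \<rho> L P"
  shows "\<exists>\<psi>' \<phi>' \<rho>' L' P'. admissible (Suc k) \<psi>' \<phi>' \<rho>' L' P' \<and> extends k \<psi> \<phi> \<rho> L P \<psi>' \<phi>' L' P'"
proof -
  have \<psi>: "area_homeo X \<psi> \<phi>" and \<rho>: "0 < \<rho>" "\<rho> \<le> \<rho>0" "\<rho> \<le> 1 / real (Suc k)"
    and near: "\<And>x. d x < 3 * \<rho> \<Longrightarrow> dist (\<psi> x) x \<le> tol k * d x \<and> dist (\<phi> x) x \<le> tol k * d x"
    and P0: "\<And>j. P j 0 = w (fst j)"
    using g unfolding admissible_def by blast+
  have "\<exists>r>0. \<forall>x. d x < r \<longrightarrow> \<psi> x = x"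
    using g unfolding admissible_def by (elim conjE)
  then obtain r0 where r0: "r0 > 0" "\<And>x. d x < r0 \<Longrightarrow> \<psi> x = x" by blast
  define r where "r = min r0 \<rho>"
  have r: "0 < r" "\<And>x. d x < r \<Longrightarrow> \<psi> x = x" "r \<le> \<rho>" using r0 \<rho> by (auto simp: r_def)
  \<comment> \<open>\<open>24 = 3 * 8\<close>: the collar \<open>d x < 3 * \<rho>'\<close> of the
    next stage lies in \<open>d x < r / 8\<close>, where the gauge grants the factor
    \<open>tol (Suc k)\<close>.\<close>
  define \<rho>' where "\<rho>' = min (r / 24) (1 / real (Suc (Suc k)))"
  have \<rho>': "0 < \<rho>'" "\<rho>' \<le> \<rho>" "3 * \<rho>' \<le> r / 8" "\<rho>' \<le> 1 / real (Suc (Suc k))"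
    using r by (auto simp: \<rho>'_def)
  have "\<exists>\<delta>. continuous_on UNIV \<delta> \<and> (\<forall>x y. \<delta> x \<le> \<delta> y + dist x y) \<and> (\<forall>x. \<delta> x \<le> d x) \<and> (\<forall>x. 0 \<le> \<delta> x)
     \<and> (\<forall>x\<in>X. 0 < \<delta> x)
     \<and> (\<forall>x\<in>X. d x < \<rho> \<longrightarrow> dist (\<psi> x) x < \<delta> (\<psi> x) / 32)
     \<and> (\<forall>h g. area_homeo X h g \<longrightarrow> (\<forall>x. dist (h x) x \<le> \<delta> x) \<longrightarrow>
          (\<forall>x. dist (h (\<psi> x)) (\<psi> x) \<le> 100 * tol k) \<and> (\<forall>x. dist (\<phi> (g x)) (\<phi> x) \<le> 100 * tol k)
          \<and> (\<forall>x. d x < r / 8 \<longrightarrow> dist (h (\<psi> x)) x \<le> tol (Suc k) * d x \<and> dist (\<phi> (g x)) x \<le> tol (Suc k) * d x))"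
    by (rule exists_gauge[OF \<psi> r near])
  then obtain \<delta> where \<delta>': "continuous_on UNIV \<delta> \<and> (\<forall>x y. \<delta> x \<le> \<delta> y + dist x y) \<and> (\<forall>x. \<delta> x \<le> d x) \<and> (\<forall>x. 0 \<le> \<delta> x)
     \<and> (\<forall>x\<in>X. 0 < \<delta> x)
     \<and> (\<forall>x\<in>X. d x < \<rho> \<longrightarrow> dist (\<psi> x) x < \<delta> (\<psi> x) / 32)
     \<and> (\<forall>h g. area_homeo X h g \<longrightarrow> (\<forall>x. dist (h x) x \<le> \<delta> x) \<longrightarrow>
          (\<forall>x. dist (h (\<psi> x)) (\<psi> x) \<le> 100 * tol k) \<and> (\<forall>x. dist (\<phi> (g x)) (\<phi> x) \<le> 100 * tol k)
          \<and> (\<forall>x. d x < r / 8 \<longrightarrow> dist (h (\<psi> x)) x \<le> tol (Suc k) * d x \<and> dist (\<phi> (g x)) x \<le> tol (Suc k) * d x))" ..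
  have \<delta>: "continuous_on UNIV \<delta>" "\<And>x y. \<delta> x \<le> \<delta> y + dist x y" "\<And>x. \<delta> x \<le> d x" "\<And>x. 0 \<le> \<delta> x"
     "\<And>x. x \<in> X \<Longrightarrow> 0 < \<delta> x" "\<And>x. x \<in> X \<Longrightarrow> d x < \<rho> \<Longrightarrow> dist (\<psi> x) x < \<delta> (\<psi> x) / 32"
    using \<delta>' by blast+
  note \<delta>h = conjunct2[OF conjunct2[OF conjunct2[OF conjunct2[OF conjunct2[OF conjunct2[OF \<delta>']]]]]]
  have "\<exists>L' P'. (\<forall>j. L j \<le> L' j) \<and> (\<forall>j. fst j \<le> k \<longrightarrow> L j < L' j) \<and> (\<forall>j. Suc k \<le> fst j \<longrightarrow> L' j = 0)
    \<and> (\<forall>j t. t \<le> L j \<longrightarrow> P' j t = P j t)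
    \<and> (\<forall>j t. fst j < k \<longrightarrow> L j \<le> t \<longrightarrow> t \<le> L' j \<longrightarrow> P' j t \<in> nbhd (K j) \<rho>)
    \<and> (\<forall>j. fst j \<le> k \<longrightarrow> dist (P' j (L' j)) (\<tau> j k) < \<rho>')
    \<and> (\<forall>j t. t \<le> L' j \<longrightarrow> P' j t \<in> X)
    \<and> inj_on (\<lambda>(j, t). P' j t) {(j, t). 0 < t \<and> t \<le> L' j}
    \<and> (\<forall>j t. 0 < t \<and> t \<le> L' j \<longrightarrow> P' j t \<notin> range w)
    \<and> (\<forall>j t. t < L' j \<longrightarrow> (if snd j then dist (\<psi> (P' j t)) (P' j (Suc t)) < \<delta> (\<psi> (P' j t)) / 32
                               else dist (\<psi> (P' j (Suc t))) (P' j t) < \<delta> (\<psi> (P' j (Suc t))) / 32))"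
    by (rule extend_orbits[OF g \<delta>(1,5,6) \<rho>'(1,2)])
  then obtain L' P' where F: "(\<forall>j. L j \<le> L' j) \<and> (\<forall>j. fst j \<le> k \<longrightarrow> L j < L' j) \<and> (\<forall>j. Suc k \<le> fst j \<longrightarrow> L' j = 0)
    \<and> (\<forall>j t. t \<le> L j \<longrightarrow> P' j t = P j t)
    \<and> (\<forall>j t. fst j < k \<longrightarrow> L j \<le> t \<longrightarrow> t \<le> L' j \<longrightarrow> P' j t \<in> nbhd (K j) \<rho>)
    \<and> (\<forall>j. fst j \<le> k \<longrightarrow> dist (P' j (L' j)) (\<tau> j k) < \<rho>')
    \<and> (\<forall>j t. t \<le> L' j \<longrightarrow> P' j t \<in> X)
    \<and> inj_on (\<lambda>(j, t). P' j t) {(j, t). 0 < t \<and> t \<le> L' j}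
    \<and> (\<forall>j t. 0 < t \<and> t \<le> L' j \<longrightarrow> P' j t \<notin> range w)
    \<and> (\<forall>j t. t < L' j \<longrightarrow> (if snd j then dist (\<psi> (P' j t)) (P' j (Suc t)) < \<delta> (\<psi> (P' j t)) / 32
                               else dist (\<psi> (P' j (Suc t))) (P' j t) < \<delta> (\<psi> (P' j (Suc t))) / 32))"
    by (elim exE) (rule that)
  note LL1 = F[THEN conjunct1, rule_format]
  note LL2 = F[THEN conjunct2, THEN conjunct1, rule_format]
  note LL3 = F[THEN conjunct2, THEN conjunct2, THEN conjunct1, rule_format]
  note PP = F[THEN conjunct2, THEN conjunct2, THEN conjunct2, THEN conjunct1, rule_format]
  note tr = F[THEN conjunct2, THEN conjunct2, THEN conjunct2, THEN conjunct2, THEN conjunct1, rule_format]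
  note ends = F[THEN conjunct2, THEN conjunct2, THEN conjunct2, THEN conjunct2, THEN conjunct2, THEN conjunct1, rule_format]
  note PX = F[THEN conjunct2, THEN conjunct2, THEN conjunct2, THEN conjunct2, THEN conjunct2, THEN conjunct2, THEN conjunct1, rule_format]
  note inj = F[THEN conjunct2, THEN conjunct2, THEN conjunct2, THEN conjunct2, THEN conjunct2, THEN conjunct2, THEN conjunct2, THEN conjunct1, rule_format]
  note Pw0 = F[THEN conjunct2, THEN conjunct2, THEN conjunct2, THEN conjunct2, THEN conjunct2, THEN conjunct2, THEN conjunct2, THEN conjunct2, THEN conjunct1, rule_format]
  note st = F[THEN conjunct2, THEN conjunct2, THEN conjunct2, THEN conjunct2, THEN conjunct2, THEN conjunct2, THEN conjunct2, THEN conjunct2, THEN conjunct2, rule_format]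
  have Pw: "\<And>j t. 0 < t \<Longrightarrow> t \<le> L' j \<Longrightarrow> P' j t \<notin> range w" using Pw0 by blast
  note LL = LL1 LL2 LL3
  have P'0: "P' j 0 = w (fst j)" for j using PP P0 by simp
  define I where "I = {(j, t). t < L' j}"
  \<comment> \<open>Steps are oriented along \<open>\<psi>\<close>, so in a backward half the later
    point is the source. Old steps are included with zero jump: \<open>h\<close> fixes their image
    points, and they persist.\<close>
  define src where "src = (\<lambda>(j :: nat \<times> bool, t). if snd j then P' j t else P' j (Suc t))"
  define tgt where "tgt = (\<lambda>(j :: nat \<times> bool, t). if snd j then P' j (Suc t) else P' j t)"
  have "finite I"
  proof -
    have "I \<subseteq> (SIGMA j:{..k} \<times> UNIV. {..<L' j})"
    proof
      fix e assume "e \<in> I"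
      then obtain i s t where e: "e = ((i, s), t)" "t < L' (i, s)" by (auto simp: I_def)
      then show "e \<in> (SIGMA j:{..k} \<times> UNIV. {..<L' j})" using LL(3)[of "(i, s)"] by (cases "i \<le> k") auto
    qed
    then show ?thesis by (rule finite_subset) auto
  qed
  \<comment> \<open>The only coincidence is the common starting point of the two halves of one
    orbit. It is a source only in the forward half and a target only in the backward half, so
    \<open>src\<close> and \<open>tgt\<close> are injective.\<close>
  have P'inj: "j = i \<and> t = s \<or> (t = 0 \<and> s = 0 \<and> fst j = fst i)"
    if "t \<le> L' j" "s \<le> L' i" "P' j t = P' i s" for i j t s
  proof (cases "t = 0"; cases "s = 0")
    assume "t = 0" "s = 0"
    then show ?thesis using that P'0 injD[OF w(1)] by auto
  next
    assume "t = 0" "s \<noteq> 0"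
    then have "P' i s \<in> range w" using that P'0[of j] by (metis rangeI)
    then show ?thesis using Pw[of s i] that \<open>s \<noteq> 0\<close> by blast
  next
    assume "t \<noteq> 0" "s = 0"
    then have "P' j t \<in> range w" using that P'0[of i] by (metis rangeI)
    then show ?thesis using Pw[of t j] that \<open>t \<noteq> 0\<close> by blast
  next
    assume "t \<noteq> 0" "s \<noteq> 0"
    then show ?thesis using inj_onD[OF inj, of "(j,t)" "(i,s)"] that by auto
  qed
  have srcinj: "inj_on src I"
  proof (rule inj_onI)
    fix a b assume ab: "a \<in> I" "b \<in> I" "src a = src b"
    obtain j t i s where e: "a = (j, t)" "b = (i, s)" by fastforce
    define t' where "t' = (if snd j then t else Suc t)"
    define s' where "s' = (if snd i then s else Suc s)"
    have "P' j t' = P' i s'" "t' \<le> L' j" "s' \<le> L' i" using ab e by (auto simp: src_def I_def t'_def s'_def)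
    then show "a = b" using P'inj[of t' j s' i] e by (auto simp: t'_def s'_def prod_eq_iff split: if_splits)
  qed
  have tgtinj: "inj_on tgt I"
  proof (rule inj_onI)
    fix a b assume ab: "a \<in> I" "b \<in> I" "tgt a = tgt b"
    obtain j t i s where e: "a = (j, t)" "b = (i, s)" by fastforce
    define t' where "t' = (if snd j then Suc t else t)"
    define s' where "s' = (if snd i then Suc s else s)"
    have "P' j t' = P' i s'" "t' \<le> L' j" "s' \<le> L' i" using ab e by (auto simp: tgt_def I_def t'_def s'_def)
    then show "a = b" using P'inj[of t' j s' i] e by (auto simp: t'_def s'_def prod_eq_iff split: if_splits)
  qed
  have "inj_on (\<lambda>e. \<psi> (src e)) I"
    using srcinj area_homeoD(3)[OF \<psi>] unfolding inj_on_def by metis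
  moreover have "dist (\<psi> (src e)) (tgt e) < \<delta> (\<psi> (src e)) / 32" if "e \<in> I" for e
  proof -
    obtain j t where e: "e = (j, t)" by fastforce
    then show ?thesis
      using st[of t j] that by (cases "snd j") (simp_all add: I_def src_def tgt_def)
  qed
  ultimately obtain h g where h: "area_homeo X h g" "\<And>e. e \<in> I \<Longrightarrow> h (\<psi> (src e)) = tgt e"
      "\<forall>x. dist (h x) x \<le> \<delta> x" "\<exists>r>0. \<forall>x. d x < r \<longrightarrow> h x = x"
    using area_homeo_realize[OF \<open>finite I\<close> _ tgtinj, of "\<lambda>e. \<psi> (src e)" \<delta> X] \<delta>(2,3,4) by blast
  obtain r1 where r1: "r1 > 0" "\<And>x. d x < r1 \<Longrightarrow> h x = x" using h(4) by blast
  note hc = \<delta>h[rule_format, OF h(1) h(3)[rule_format]]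
  have "admissible (Suc k) (\<lambda>x. h (\<psi> x)) (\<lambda>x. \<phi> (g x)) \<rho>' L' P'"
    unfolding admissible_def
  proof (intro conjI allI impI)
    show "area_homeo X (\<lambda>x. h (\<psi> x)) (\<lambda>x. \<phi> (g x))" by (rule area_homeo_comp[OF h(1) \<psi>])
    show "\<exists>r>0. \<forall>x. d x < r \<longrightarrow> h (\<psi> x) = x"
      using r0 r1 by (intro exI[of _ "min r0 r1"]) auto
    show "dist (h (\<psi> x)) x \<le> tol (Suc k) * d x" "dist (\<phi> (g x)) x \<le> tol (Suc k) * d x" if "d x < 3 * \<rho>'" for x
      using hc that \<rho>'(3) by (meson order_less_le_trans)+
    show "step (\<lambda>x. h (\<psi> x)) (snd j) (P' j t) (P' j (Suc t))" if "t < L' j" for j t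
      using h(2)[of "(j, t)"] that by (auto simp: step_def I_def src_def tgt_def)
    show "P' j (L' j) \<in> nbhd (K j) \<rho>'" if "fst j < Suc k" for j
      using ends[of j] that \<tau>(1)[of j k] by (auto simp: nbhd_def dist_commute)
  qed (use \<rho> \<rho>' P'0 LL PX inj Pw in auto)
  moreover have "extends k \<psi> \<phi> \<rho> L P (\<lambda>x. h (\<psi> x)) (\<lambda>x. \<phi> (g x)) L' P'"
    unfolding extends_def
  proof (intro conjI allI impI)
    show "dist (P' j (L' j)) (\<tau> j k) < 1 / real (Suc k)" if "fst j \<le> k" for j
      using ends[OF that] \<rho>'(2) \<rho>(3) by linarith
  qed (use hc LL PP tr in auto)
  ultimately show ?thesis by blast
qed

end

section \<open>The limit homeomorphism\<close>

lemma geometric_uniform_limit: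
  fixes F :: "nat \<Rightarrow> 'a::topological_space \<Rightarrow> 'b::complete_space"
  assumes cont: "\<And>k. continuous_on UNIV (F k)"
    and F: "\<And>k x. dist (F (Suc k) x) (F k x) \<le> (1/2) ^ k / 2"
  shows "\<exists>G. continuous_on UNIV G \<and> (\<forall>k x. dist (F k x) (G x) \<le> (1/2) ^ k)"
proof -
  have tel: "dist (F (k + n) x) (F k x) \<le> (1/2) ^ k" for k n x
  proof -
    have "dist (F (k + n) x) (F k x) \<le> (1/2) ^ k - (1/2) ^ (k + n)"
    proof (induction n)
      case (Suc n)
      have "dist (F (k + Suc n) x) (F k x) \<le> dist (F (Suc (k + n)) x) (F (k + n) x) + dist (F (k + n) x) (F k x)"
        by (simp add: dist_triangle)
      then show ?case using Suc F[of "k + n" x] by simp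
    qed simp
    also have "\<dots> \<le> (1/2) ^ k" by simp
    finally show ?thesis .
  qed
  have half: "(\<lambda>k. (1/2 :: real) ^ k) \<longlonglongrightarrow> 0" by (rule LIMSEQ_power_zero) simp
  have "Cauchy (\<lambda>k. F k x)" for x
  proof (rule metric_CauchyI)
    fix e :: real assume "e > 0"
    then have "\<forall>\<^sub>F k in sequentially. (1/2::real) ^ k < e / 2"
      using order_tendstoD(2)[OF half, of "e / 2"] by simp
    then obtain M where M: "(1/2::real) ^ M < e / 2" by (auto simp: eventually_sequentially)
    have "dist (F m x) (F n x) < e" if "m \<ge> M" "n \<ge> M" for m n
    proof -
      have "dist (F m x) (F M x) < e / 2" "dist (F n x) (F M x) < e / 2"
        using tel[of M "m - M" x] tel[of M "n - M" x] M that by auto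
      then show ?thesis by (rule dist_triangle_half_l)
    qed
    then show "\<exists>M. \<forall>m\<ge>M. \<forall>n\<ge>M. dist (F m x) (F n x) < e" by blast
  qed
  then have "\<forall>x. \<exists>l. (\<lambda>k. F k x) \<longlonglongrightarrow> l" using Cauchy_convergent convergent_def by blast
  then obtain G where G: "\<And>x. (\<lambda>k. F k x) \<longlonglongrightarrow> G x" by metis
  have d: "dist (F k x) (G x) \<le> (1/2) ^ k" for k x
  proof -
    have "(\<lambda>n. dist (F (n + k) x) (F k x)) \<longlonglongrightarrow> dist (G x) (F k x)"
      by (intro tendsto_intros LIMSEQ_ignore_initial_segment G)
    then have "dist (G x) (F k x) \<le> (1/2) ^ k"
      by (rule LIMSEQ_le_const2) (intro exI[of _ 0], use tel[of k] in \<open>simp add: add.commute\<close>)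
    then show ?thesis by (simp add: dist_commute)
  qed
  have "uniform_limit UNIV F G sequentially"
    unfolding uniform_limit_iff
  proof (intro allI impI)
    fix e :: real assume "e > 0"
    then have "\<forall>\<^sub>F k in sequentially. (1/2::real) ^ k < e"
      using order_tendstoD(2)[OF half] by blast
    then show "\<forall>\<^sub>F n in sequentially. \<forall>x\<in>UNIV. dist (F n x) (G x) < e"
      by eventually_elim (use d in \<open>meson order_le_less_trans\<close>)
  qed
  then have "continuous_on UNIV G" using cont by (intro uniform_limit_theorem) auto
  then show ?thesis using d by blast
qed

context target_system
begin

lemma initial_admissible: "admissible 0 (\<lambda>x. x) (\<lambda>x. x) (min \<rho>0 1) (\<lambda>_. 0) (\<lambda>j _. w (fst j))"
proof -
  have "0 \<le> tol 0 * d x" for x using infdist_nonneg[of x "- X"] by (simp add: less_imp_le)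
  moreover have "inj_on (\<lambda>(j, t). w (fst j)) {(j :: nat \<times> bool, t). 0 < t \<and> t \<le> (0::nat)}"
    by (rule inj_onI) auto
  ultimately show ?thesis
    unfolding admissible_def using \<rho>0(1) w(2) by (simp add: area_homeo_id exI[of _ "1::real"] del: neq0_conv)
qed

lemma exists_stages:
  obtains \<Psi> \<Phi> R L P where "\<And>k. admissible k (\<Psi> k) (\<Phi> k) (R k) (L k) (P k)"
    "\<And>k. extends k (\<Psi> k) (\<Phi> k) (R k) (L k) (P k) (\<Psi> (Suc k)) (\<Phi> (Suc k)) (L (Suc k)) (P (Suc k))"
proof -
  define G where "G k = (\<lambda>(\<psi>, \<phi>, \<rho>, L, P). admissible k \<psi> \<phi> \<rho> L P)" for k
  define S where "S k = (\<lambda>(\<psi>, \<phi>, \<rho>, L, P) (\<psi>', \<phi>', \<rho>'::real, L', P'). extends k \<psi> \<phi> \<rho> L P \<psi>' \<phi>' L' P')" for k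
  have "\<exists>x. G 0 x" using initial_admissible unfolding G_def by fastforce
  moreover have "\<exists>y. G (Suc k) y \<and> S k x y" if "G k x" for k x
  proof -
    obtain \<psi> \<phi> \<rho> L P where x: "x = (\<psi>, \<phi>, \<rho>, L, P)" by (cases x)
    then have "admissible k \<psi> \<phi> \<rho> L P" using \<open>G k x\<close> by (simp add: G_def)
    from next_stage[OF this] obtain \<psi>' \<phi>' \<rho>' L' P'
      where "admissible (Suc k) \<psi>' \<phi>' \<rho>' L' P'" "extends k \<psi> \<phi> \<rho> L P \<psi>' \<phi>' L' P'"
      by (elim exE conjE) (rule that)
    then show ?thesis unfolding x by (intro exI[of _ "(\<psi>', \<phi>', \<rho>', L', P')"]) (simp add: G_def S_def)
  qed
  ultimately obtain f where f: "\<And>k. G k (f k)" "\<And>k. S k (f k) (f (Suc k))"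
    using dependent_nat_choice[of G S] by blast
  show ?thesis
    by (rule that[of "\<lambda>k. fst (f k)" "\<lambda>k. fst (snd (f k))" "\<lambda>k. fst (snd (snd (f k)))"
        "\<lambda>k. fst (snd (snd (snd (f k))))" "\<lambda>k. snd (snd (snd (snd (f k))))"])
      (use f in \<open>simp_all add: G_def S_def case_prod_beta\<close>)
qed

text \<open>Both \<open>\<Psi> k\<close> and \<open>\<Phi> k\<close> converge uniformly, so the
  limits are continuous and inverse to each other. A prescribed step stays valid at all later
  stages, hence also for the limit map.\<close>

theorem exists_homeomorphism:
  "\<exists>\<psi> \<phi>. homeomorphism UNIV UNIV \<psi> \<phi> \<and> (\<forall>x. x \<notin> X \<longrightarrow> \<psi> x = x)
     \<and> (\<forall>i. omega_limit \<psi> (w i) = K (i, True) \<and> omega_limit \<phi> (w i) = K (i, False))"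
proof -
  obtain \<Psi> \<Phi> R L P where admissible: "\<And>k. admissible k (\<Psi> k) (\<Phi> k) (R k) (L k) (P k)"
    and extends: "\<And>k. extends k (\<Psi> k) (\<Phi> k) (R k) (L k) (P k) (\<Psi> (Suc k)) (\<Phi> (Suc k)) (L (Suc k)) (P (Suc k))"
    using exists_stages by blast
  have area_homeo: "area_homeo X (\<Psi> k) (\<Phi> k)" for k using admissible[of k] unfolding admissible_def by (elim conjE)
  have R: "R k \<le> 1 / real (Suc k)" for k using admissible[of k] unfolding admissible_def by (elim conjE)
  have P0: "P k j 0 = w (fst j)" for k j using admissible[of k] unfolding admissible_def by (elim conjE) (rule spec)
  have st: "step (\<Psi> k) (snd j) (P k j t) (P k j (Suc t))" if "t < L k j" for k j t
    using admissible[of k] that unfolding admissible_def by (elim conjE) blast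
  have s1: "dist (\<Psi> (Suc k) x) (\<Psi> k x) \<le> 100 * tol k" for k x using extends[of k] unfolding extends_def by (elim conjE) (rule spec)
  have s2: "dist (\<Phi> (Suc k) x) (\<Phi> k x) \<le> 100 * tol k" for k x using extends[of k] unfolding extends_def by (elim conjE) (rule spec)
  have s3: "L k j \<le> L (Suc k) j" for k j using extends[of k] unfolding extends_def by (elim conjE) (rule spec)
  have s4: "L k j < L (Suc k) j" if "fst j \<le> k" for k j using extends[of k] that unfolding extends_def by (elim conjE) blast
  have s5: "P (Suc k) j t = P k j t" if "t \<le> L k j" for k j t using extends[of k] that unfolding extends_def by (elim conjE) blast
  have s6: "P (Suc k) j t \<in> nbhd (K j) (R k)" if "fst j < k" "L k j \<le> t" "t \<le> L (Suc k) j" for k j t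
    using extends[of k] that unfolding extends_def by (elim conjE) blast
  have s7: "dist (P (Suc k) j (L (Suc k) j)) (\<tau> j k) < 1 / real (Suc k)" if "fst j \<le> k" for k j
    using extends[of k] that unfolding extends_def by (elim conjE) blast
  have t: "100 * tol k \<le> (1/2) ^ k / 2" for k by (simp add: tol_def)
  obtain \<psi> where \<psi>: "continuous_on UNIV \<psi>" "\<And>k x. dist (\<Psi> k x) (\<psi> x) \<le> (1/2) ^ k"
    using geometric_uniform_limit[of \<Psi>] area_homeoD(1)[OF area_homeo] order_trans[OF s1 t] by blast
  obtain \<phi> where \<phi>: "continuous_on UNIV \<phi>" "\<And>k x. dist (\<Phi> k x) (\<phi> x) \<le> (1/2) ^ k"
    using geometric_uniform_limit[of \<Phi>] area_homeoD(2)[OF area_homeo] order_trans[OF s2 t] by blast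
  have half: "(\<lambda>k. (1/2 :: real) ^ k) \<longlonglongrightarrow> 0" by (rule LIMSEQ_power_zero) simp
  have lim: "u \<longlonglongrightarrow> l" if "\<And>k. dist (u k) l \<le> (1/2) ^ k" for u :: "nat \<Rightarrow> real \<times> real" and l
    by (rule metric_tendsto_imp_tendsto[OF half]) (use that in auto)
  have \<Psi>lim: "(\<lambda>k. \<Psi> k x) \<longlonglongrightarrow> \<psi> x" and \<Phi>lim: "(\<lambda>k. \<Phi> k x) \<longlonglongrightarrow> \<phi> x" for x
    by (rule lim[OF \<psi>(2)], rule lim[OF \<phi>(2)])
  have inv1: "\<psi> (\<phi> x) = x" for x
  proof (rule LIMSEQ_unique)
    have "isCont \<psi> (\<phi> x)" using \<psi>(1) continuous_on_eq_continuous_at[OF open_UNIV] by blast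
    then show "(\<lambda>k. \<psi> (\<Phi> k x)) \<longlonglongrightarrow> \<psi> (\<phi> x)" using \<Phi>lim by (rule isCont_tendsto_compose)
    \<comment> \<open>\<open>\<psi>\<close> is uniformly close to \<open>\<Psi> k\<close>, and
      \<open>\<Psi> k (\<Phi> k x) = x\<close>.\<close>
    show "(\<lambda>k. \<psi> (\<Phi> k x)) \<longlonglongrightarrow> x"
      using \<psi>(2)[of _ "\<Phi> _ x"] area_homeoD(4)[OF area_homeo] by (intro lim) (metis dist_commute)
  qed
  have inv2: "\<phi> (\<psi> x) = x" for x
  proof (rule LIMSEQ_unique)
    have "isCont \<phi> (\<psi> x)" using \<phi>(1) continuous_on_eq_continuous_at[OF open_UNIV] by blast
    then show "(\<lambda>k. \<phi> (\<Psi> k x)) \<longlonglongrightarrow> \<phi> (\<psi> x)" using \<Psi>lim by (rule isCont_tendsto_compose)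
    show "(\<lambda>k. \<phi> (\<Psi> k x)) \<longlonglongrightarrow> x"
      using \<phi>(2)[of _ "\<Psi> _ x"] area_homeoD(3)[OF area_homeo] by (intro lim) (metis dist_commute)
  qed
  have "homeomorphism UNIV UNIV \<psi> \<phi>"
    by (rule homeomorphismI) (use \<psi> \<phi> inv1 inv2 in auto)
  moreover have "\<psi> x = x" if "x \<notin> X" for x
    using LIMSEQ_unique[OF \<Psi>lim[of x]] area_homeoD(7)[OF area_homeo that] by simp
  moreover have orbits: "omega_limit f (w (fst j)) = K j" if f: "f = (if snd j then \<psi> else \<phi>)" for f j
  proof -
    have Lge: "n \<le> L (fst j + n) j" for n
    proof (induction n)
      case (Suc n)
      then show ?case using s4[of j "fst j + n"] by simp
    qed simp
    have Lmono: "L k j \<le> L (k + n) j" for k n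
    proof (induction n)
      case (Suc n)
      then show ?case using s3[of "k + n" j] by simp
    qed simp
    have Pmono: "P (k + n) j t = P k j t" if "t \<le> L k j" for k n t
    proof (induction n)
      case (Suc n)
      then show ?case using s5[of t "k + n" j] Lmono[of k n] that by simp
    qed simp
    \<comment> \<open>From stage \<open>fst j\<close> on every stage lengthens the segment, so point
      number \<open>t\<close> exists at stage \<open>fst j + t\<close>.\<close>
    define Q where "Q t = P (fst j + t) j t" for t
    have Q: "P k j t = Q t" if "t \<le> L k j" for k t
    proof -
      have "P (k + (fst j + t)) j t = P k j t" using that by (rule Pmono)
      moreover have "P ((fst j + t) + k) j t = Q t" unfolding Q_def using Lge by (rule Pmono)
      ultimately show ?thesis by (simp add: add.commute)
    qed
    have fQ: "f (Q t) = Q (Suc t)" for t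
    proof -
      define k0 where "k0 = fst j + Suc t"
      have Lk: "Suc t \<le> L (n + k0) j" for n
        using Lge[of "Suc t"] Lmono[of k0 n] by (simp add: k0_def add.commute)
      have s: "step (\<Psi> (n + k0)) (snd j) (Q t) (Q (Suc t))" for n
        using st[of t "n + k0" j] Q[of t "n + k0"] Q[of "Suc t" "n + k0"] Lk[of n] by simp
      have l: "(\<lambda>n. \<Psi> (n + k0) x) \<longlonglongrightarrow> \<psi> x" for x
        by (rule LIMSEQ_ignore_initial_segment[OF \<Psi>lim])
      show ?thesis
      proof (cases "snd j")
        case True
        then have "\<Psi> (n + k0) (Q t) = Q (Suc t)" for n using s[of n] by (simp add: step_def)
        then have "\<psi> (Q t) = Q (Suc t)" using LIMSEQ_unique[OF l[of "Q t"]] by simp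
        then show ?thesis using f True by simp
      next
        case False
        then have "\<Psi> (n + k0) (Q (Suc t)) = Q t" for n using s[of n] by (simp add: step_def)
        then have "\<psi> (Q (Suc t)) = Q t" using LIMSEQ_unique[OF l[of "Q (Suc t)"]] by simp
        then show ?thesis using f False inv2 by metis
      qed
    qed
    have iter: "(f ^^ n) (w (fst j)) = Q n" for n
    proof (induction n)
      case 0
      then show ?case using P0 by (simp add: Q_def)
    next
      case (Suc n)
      then show ?case using fQ by simp
    qed
    have near: "Q t \<in> nbhd (K j) (1 / real (Suc k))" if k: "fst j < k" "L k j \<le> t" for k t
    proof -
      have "t < L (fst j + Suc t) j" using Lge[of "Suc t"] by simp
      also have "\<dots> \<le> L (k + (fst j + Suc t)) j" using Lmono[of "fst j + Suc t" k] by (simp add: add.commute)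
      finally have ex: "t < L (k + (fst j + Suc t)) j" .
      \<comment> \<open>In the transition into this least stage, \<open>t\<close> belongs to the
        confined range, so \<open>s6\<close> applies; the radius there is at most
        \<open>1 / Suc k\<close>.\<close>
      define n where "n = (LEAST n. t < L (k + n) j)"
      have n: "t < L (k + n) j" unfolding n_def using ex by (rule LeastI)
      have "n \<noteq> 0" using n k by (cases n) auto
      then obtain n' where n': "n = Suc n'" using not0_implies_Suc by blast
      have "\<not> t < L (k + n') j" using not_less_Least[of n' "\<lambda>n. t < L (k + n) j"] n' unfolding n_def by simp
      then have "P (Suc (k + n')) j t \<in> nbhd (K j) (R (k + n'))"
        using s6[of j "k + n'" t] k n n' by simp
      then have "Q t \<in> nbhd (K j) (R (k + n'))" using Q[of t "Suc (k + n')"] n n' by simp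
      moreover have "R (k + n') \<le> 1 / real (Suc k)"
        using R[of "k + n'"] by (rule order_trans) (simp add: frac_le)
      ultimately show ?thesis unfolding nbhd_def by force
    qed
    have om: "omega_limit f (w (fst j)) = (\<Inter>N. closure {Q n | n. n \<ge> N})"
      unfolding omega_limit_def iter ..
    have Kne: "K j \<noteq> {}" using \<tau>(1)[of j] by blast
    show ?thesis
    proof (rule antisym; rule subsetI)
      fix y assume y: "y \<in> omega_limit f (w (fst j))"
      have "infdist y (K j) \<le> 1 / real (Suc k)" if "fst j < k" for k
      proof -
        have "y \<in> closure {Q n | n. n \<ge> L k j}" using y unfolding om by blast
        moreover have "{Q n | n. n \<ge> L k j} \<subseteq> {x. infdist x (K j) \<le> 1 / real (Suc k)}"
        proof
          fix x assume "x \<in> {Q n | n. n \<ge> L k j}"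
          then obtain n where x: "x = Q n" and "L k j \<le> n" by blast
          then obtain z where "z \<in> K j" "dist z (Q n) < 1 / real (Suc k)"
            using near[OF \<open>fst j < k\<close>, of n] unfolding nbhd_def by (metis UN_E mem_ball)
          then have "infdist (Q n) (K j) \<le> 1 / real (Suc k)"
            using infdist_le[of z "K j" "Q n"] by (simp add: dist_commute)
          then show "x \<in> {x. infdist x (K j) \<le> 1 / real (Suc k)}" using x by simp
        qed
        moreover have "closed {x. infdist x (K j) \<le> 1 / real (Suc k)}"
          by (intro closed_Collect_le continuous_intros)
        ultimately show ?thesis using closure_minimal by blast
      qed
      then have "infdist y (K j) \<le> 0"
        by (intro LIMSEQ_le_const[OF lim_1_over_n[THEN LIMSEQ_Suc]]) (meson less_eq_Suc_le)
      then have "infdist y (K j) = 0" using infdist_nonneg[of y "K j"] by linarith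
      then show "y \<in> K j"
        using in_closed_iff_infdist_zero[of "K j" y] K(1)[of j] compact_imp_closed Kne by blast
    next
      fix y assume y: "y \<in> K j"
      show "y \<in> omega_limit f (w (fst j))"
        unfolding om
      proof (intro INT_I)
        fix N
        show "y \<in> closure {Q n | n. n \<ge> N}"
          unfolding closure_approachable
        proof (intro allI impI)
          fix e :: real assume "e > 0"
          then obtain M where M: "1 / real (Suc M) < e / 2" using nat_approx_posE[of "e/2"] by auto
          \<comment> \<open>A large \<open>k\<close> serves three purposes: the goal is near
            \<open>y\<close>, the end of the segment is near the goal, and the index of that end
            exceeds \<open>N\<close>.\<close>
          obtain k where k: "k \<ge> fst j + N + M" "dist (\<tau> j k) y < e / 2"
            using \<tau>_dense[OF y, of "e/2" "fst j + N + M"] \<open>e > 0\<close> by auto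
          define n where "n = L (Suc k) j"
          have "N \<le> Suc k - fst j" using k by simp
          also have "\<dots> \<le> n" using Lge[of "Suc k - fst j"] k by (simp add: n_def)
          finally have "N \<le> n" .
          have "dist (Q n) (\<tau> j k) < 1 / real (Suc k)"
            using s7[of j k] k Q[of n "Suc k"] by (simp add: n_def)
          also have "\<dots> \<le> 1 / real (Suc M)" using k by (simp add: frac_le)
          finally have "dist (Q n) y < e"
            using M k(2) dist_triangle[of "Q n" y "\<tau> j k"] by linarith
          then show "\<exists>x\<in>{Q n | n. n \<ge> N}. dist x y < e" using \<open>N \<le> n\<close> by blast
        qed
      qed
    qed
  qed
  ultimately show ?thesis
    using orbits[of \<psi> "(_, True)"] orbits[of \<phi> "(_, False)"] by (intro exI[of _ \<psi>] exI[of _ \<phi>]) auto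
qed

end

section \<open>Trees in the plane\<close>

text \<open>Janiszewski's theorem for the complex plane, transported along the obvious
  homeomorphism.\<close>

lemma Janiszewski_prod:
  fixes a b :: "real \<times> real"
  assumes "compact S" "closed T" "connected (S \<inter> T)"
    and "connected_component (- S) a b" "connected_component (- T) a b"
  shows "connected_component (- (S \<union> T)) a b"
proof -
  define c where "c z = Complex (fst z) (snd z)" for z
  define c' where "c' z = (Re z, Im z)" for z
  have cc: "c' (c z) = z" "c (c' y) = y" for z y by (auto simp: c_def c'_def)
  have cont: "continuous_on A c" "continuous_on B c'" for A B
    unfolding c_def c'_def Complex_eq by (intro continuous_intros)+
  have im: "c ` A = c' -` A" for A using cc by (auto simp: image_iff) (metis cc)
  have tr: "connected_component (- (c ` A)) (c a) (c b)" if "connected_component (- A) a b" for A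
  proof -
    obtain t where t: "connected t" "t \<subseteq> - A" "a \<in> t" "b \<in> t"
      using \<open>connected_component (- A) a b\<close> unfolding connected_component_def by blast
    have "connected (c ` t)" using t(1) by (intro connected_continuous_image cont)
    moreover have "c ` t \<subseteq> - (c ` A)" using t(2) cc by (auto simp: im)
    ultimately show ?thesis using t unfolding connected_component_def by blast
  qed
  have "connected_component (- (c ` S \<union> c ` T)) (c a) (c b)"
  proof (rule Janiszewski)
    show "compact (c ` S)" using assms(1) by (intro compact_continuous_image cont)
    show "closed (c ` T)" unfolding im using assms(2) by (intro closed_vimage cont)
    have "c ` S \<inter> c ` T = c ` (S \<inter> T)" by (simp add: im)
    then show "connected (c ` S \<inter> c ` T)" using assms(3) by (auto intro: connected_continuous_image cont)
  qed (use assms tr in auto)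
  then obtain t where t: "connected t" "t \<subseteq> - (c ` S \<union> c ` T)" "c a \<in> t" "c b \<in> t"
    unfolding connected_component_def by blast
  have "connected (c' ` t)" using t(1) by (intro connected_continuous_image cont)
  moreover have "c' ` t \<subseteq> - (S \<union> T)" using t(2) by (auto simp: im)
  moreover have "a \<in> c' ` t" "b \<in> c' ` t" using t(3,4) cc by (metis image_eqI)+
  ultimately show ?thesis unfolding connected_component_def by blast
qed

lemma connected_Compl_Un:
  fixes S T :: "(real \<times> real) set"
  assumes "compact S" "closed T" "connected (S \<inter> T)" "connected (- S)" "connected (- T)"
  shows "connected (- (S \<union> T))"
  unfolding connected_iff_connected_component
proof (intro ballI)
  fix a b assume ab: "a \<in> - (S \<union> T)" "b \<in> - (S \<union> T)"
  then have "connected_component (- S) a b" "connected_component (- T) a b"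
    using assms(4,5) unfolding connected_iff_connected_component by blast+
  then show "connected_component (- (S \<union> T)) a b"
    using assms by (intro Janiszewski_prod)
qed

lemma simple_closed_path_is_circle:
  assumes "simple_path p" "pathfinish p = pathstart p"
  shows "is_circle (path_image p)"
proof -
  have "path_image p homeomorphic sphere (0::complex) 1"
    by (rule homeomorphic_simple_path_image_circle[OF assms]) simp
  moreover have "sphere (0::complex) 1 homeomorphic sphere (0::pt) 1"
    by (rule homeomorphic_spheres_gen) auto
  ultimately show ?thesis unfolding is_circle_def by (rule homeomorphic_trans)
qed

text \<open>Add the arcs one at a time, keeping the union connected. The next arc meets the previous ones
  in a single endpoint, since two common points would produce a circle.\<close>

lemma connected_Compl_tree:
  assumes T: "is_tree T"
  shows "connected (- T)"
proof -
  obtain F :: "(real \<Rightarrow> pt) set" where F: "finite F" "\<And>g. g \<in> F \<Longrightarrow> arc g" "T = (\<Union>g\<in>F. path_image g)"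
    and cross: "\<And>g h. g \<in> F \<Longrightarrow> h \<in> F \<Longrightarrow> path_image g \<noteq> path_image h \<Longrightarrow>
      path_image g \<inter> path_image h \<subseteq> {pathstart g, pathfinish g} \<inter> {pathstart h, pathfinish h}"
    and nocirc: "\<And>C. C \<subseteq> T \<Longrightarrow> \<not> is_circle C"
    using T unfolding is_tree_def by metis
  have cT: "connected T" "T \<noteq> {}" using T by (auto simp: is_tree_def continuum_def)
  define U where "U G = (\<Union>g\<in>G. path_image g)" for G :: "(real \<Rightarrow> pt) set"
  \<comment> \<open>Path connectedness is included in order to close a second contact to a loop. A
    maximal member will turn out to cover \<open>T\<close>.\<close>
  define A where "A = {G. G \<subseteq> F \<and> G \<noteq> {} \<and> path_connected (U G) \<and> connected (- U G)}"
  have "finite A" using F(1) by (auto simp: A_def)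
  obtain g0 where g0: "g0 \<in> F" using cT(2) F(3) by blast
  have "{g0} \<in> A"
    using g0 F(2)[OF g0] by (auto simp: A_def U_def arc_imp_path path_connected_path_image connected_arc_complement)
  then obtain G where G: "G \<in> A" and max: "\<And>H. H \<in> A \<Longrightarrow> G \<subseteq> H \<Longrightarrow> G = H"
    using finite_has_maximal[OF \<open>finite A\<close>] by blast
  have GF: "G \<subseteq> F" "G \<noteq> {}" "path_connected (U G)" "connected (- U G)" using G by (auto simp: A_def)
  have clU: "compact (U H)" if "H \<subseteq> F" for H
    using that F by (auto simp: U_def intro!: compact_UN compact_arc_image finite_subset[OF that])
  have "path_image h \<subseteq> U G" if h: "h \<in> F" and meet: "path_image h \<inter> U G \<noteq> {}" for h
  proof (rule ccontr)
    assume not: "\<not> path_image h \<subseteq> U G"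
    have ends: "path_image h \<inter> U G \<subseteq> {pathstart h, pathfinish h}"
    proof
      fix x assume "x \<in> path_image h \<inter> U G"
      then obtain g where g: "g \<in> G" "x \<in> path_image g" "x \<in> path_image h" by (auto simp: U_def)
      \<comment> \<open>Different paths may share an image, and then the crossing condition is
        silent; here \<open>h\<close> leaves \<open>U G\<close>, so this cannot happen.\<close>
      then have "path_image g \<noteq> path_image h" using not by (auto simp: U_def)
      then show "x \<in> {pathstart h, pathfinish h}" using cross[of g h] g GF(1) h by blast
    qed
    have notboth: "\<not> (pathstart h \<in> U G \<and> pathfinish h \<in> U G)"
    proof
      assume both: "pathstart h \<in> U G \<and> pathfinish h \<in> U G"
      have "pathfinish h \<noteq> pathstart h" using F(2)[OF h] arc_distinct_ends by blast
      then obtain p where p: "arc p" "path_image p \<subseteq> U G" "pathstart p = pathfinish h" "pathfinish p = pathstart h"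
        using both GF(3) unfolding path_connected_arcwise by metis
      \<comment> \<open>\<open>p\<close> runs inside \<open>U G\<close>, which meets
        \<open>h\<close> in endpoints of \<open>h\<close> only, so the loop is simple.\<close>
      have "simple_path (h +++ p)"
        using p ends by (intro simple_path_join_loop F(2)[OF h]) auto
      then have "is_circle (path_image (h +++ p))"
        by (rule simple_closed_path_is_circle) (simp add: p)
      moreover have "path_image (h +++ p) \<subseteq> T"
        using path_image_join_subset[of h p] p(2) GF(1) h F(3) by (fastforce simp: U_def)
      ultimately show False using nocirc by blast
    qed
    obtain x where x: "x \<in> path_image h \<inter> U G" using meet by blast
    have "path_image h \<inter> U G = {x}" using x ends notboth by blast
    then have con: "connected (path_image h \<inter> U G)" by simp
    have Uins: "U (insert h G) = path_image h \<union> U G" by (simp add: U_def)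
    have "connected (- (path_image h \<union> U G))"
      using connected_Compl_Un[OF compact_arc_image[OF F(2)[OF h]] compact_imp_closed[OF clU[OF GF(1)]] con]
        connected_arc_complement[OF F(2)[OF h]] GF(4) by simp
    moreover have "path_connected (path_image h \<union> U G)"
      using F(2)[OF h] GF(3) meet by (intro path_connected_Un) (auto simp: arc_imp_path path_connected_path_image)
    ultimately have "insert h G \<in> A" using GF h by (auto simp: A_def Uins)
    then have "G = insert h G" using max by blast
    then show False using not by (auto simp: U_def)
  qed
  then have dich: "path_image h \<subseteq> U G \<or> path_image h \<inter> U G = {}" if "h \<in> F" for h using that by blast
  \<comment> \<open>The remaining arcs miss \<open>U G\<close>. Both unions are closed and
    \<open>T\<close> is connected, so the union over \<open>B\<close> is empty.\<close>
  define B where "B = {h \<in> F. path_image h \<inter> U G = {}}"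
  have TB: "T = U G \<union> U B" "U G \<inter> U B = {}"
    using dich GF(1) F(3) by (fastforce simp: U_def B_def)+
  have cl: "closed (U G)" "closed (U B)"
    using clU[OF GF(1)] clU[of B] by (simp_all add: compact_imp_closed B_def)
  have "U G \<noteq> {}"
  proof -
    obtain g where "g \<in> G" using GF(2) by blast
    then show ?thesis using path_image_nonempty[of g] unfolding U_def by blast
  qed
  then have "U G \<inter> T \<noteq> {}" unfolding TB(1) by (simp add: Int_absorb1)
  moreover have "U G \<inter> T = {} \<or> U B \<inter> T = {}"
    by (rule connected_closedD[OF cT(1) _ _ cl]) (simp_all add: TB)
  ultimately have "U B \<inter> T = {}" by simp
  then have "U B = {}" unfolding TB(1) by (simp add: Int_absorb1)
  then show ?thesis using TB GF(4) by simp
qed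

text \<open>A disc contains a circle. This will place the tree in the closure of
  \<open>X\<close>.\<close>

lemma interior_tree:
  assumes "is_tree T"
  shows "interior T = {}"
proof (rule ccontr)
  assume "interior T \<noteq> {}"
  then obtain x where "x \<in> interior T" by blast
  then obtain e where "e > 0" "ball x e \<subseteq> T" unfolding mem_interior by blast
  moreover have "sphere x (e / 2) \<subseteq> ball x e" using \<open>e > 0\<close> by auto
  moreover have "is_circle (sphere x (e / 2))"
    unfolding is_circle_def using \<open>e > 0\<close> by (intro homeomorphic_spheres) auto
  ultimately have "sphere x (e / 2) \<subseteq> T \<and> is_circle (sphere x (e / 2))" by simp
  moreover have "\<not> (\<exists>C\<subseteq>T. is_circle C)" using assms unfolding is_tree_def by (elim conjE)
  ultimately show False by (metis (no_types))
qed

lemma compact_tree: "is_tree T \<Longrightarrow> compact T" and connected_tree: "is_tree T \<Longrightarrow> connected T"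
  and tree_nonempty: "is_tree T \<Longrightarrow> T \<noteq> {}"
  by (auto simp: is_tree_def continuum_def)

text \<open>By Janiszewski, applied to the next tree and the closed union of the complement of
  \<open>Q\<close> with the other trees: their intersection is empty, hence connected.\<close>

lemma connected_Diff_trees:
  assumes "finite M" "open Q" "connected Q"
    and "\<And>j. j \<in> M \<Longrightarrow> is_tree (T j) \<and> T j \<subseteq> Q"
    and "\<And>i j. i \<in> M \<Longrightarrow> j \<in> M \<Longrightarrow> i \<noteq> j \<Longrightarrow> T i \<inter> T j = {}"
  shows "connected (Q - (\<Union>j\<in>M. T j))"
  using assms(1,4,5)
proof (induction M rule: finite_induct)
  case empty
  then show ?case using assms(3) by simp
next
  case (insert k M)
  have tk: "is_tree (T k)" "T k \<subseteq> Q" using insert.prems(1) by auto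
  define C where "C = - Q \<union> (\<Union>j\<in>M. T j)"
  have "closed (\<Union>j\<in>M. T j)"
    using insert.hyps(1) insert.prems(1) by (intro closed_UN) (auto intro: compact_imp_closed compact_tree)
  then have "closed C" using assms(2) by (auto simp: C_def)
  moreover have "T k \<inter> C = {}"
  proof -
    have "T k \<inter> T j = {}" if "j \<in> M" for j using insert.prems(2)[of k j] insert.hyps(2) that by auto
    then show ?thesis using tk by (auto simp: C_def)
  qed
  moreover have "- C = Q - (\<Union>j\<in>M. T j)" by (auto simp: C_def)
  moreover have "connected (Q - (\<Union>j\<in>M. T j))" by (rule insert.IH) (use insert.prems in auto)
  ultimately have "connected (- (T k \<union> C))"
    by (intro connected_Compl_Un) (use tk in \<open>auto intro: compact_tree connected_Compl_tree\<close>)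
  moreover have "- (T k \<union> C) = Q - (\<Union>j\<in>insert k M. T j)" by (auto simp: C_def)
  ultimately show ?case by simp
qed

section \<open>Thin collars of the targets\<close>

lemma nbhd_subset_open:
  fixes K :: "'a::heine_borel set"
  assumes "compact K" "open Q" "K \<subseteq> Q"
  shows "\<exists>r>0. \<forall>r'\<le>r. nbhd K r' \<subseteq> Q"
proof -
  have "closed (- Q)" "K \<inter> - Q = {}" using assms by auto
  then obtain r where r: "r > 0" "\<And>x y. x \<in> K \<Longrightarrow> y \<in> - Q \<Longrightarrow> r \<le> dist x y"
    using separate_compact_closed[OF assms(1)] by metis
  have "nbhd K r' \<subseteq> Q" if "r' \<le> r" for r'
  proof
    fix y assume "y \<in> nbhd K r'"
    then obtain x where "x \<in> K" "dist x y < r'" by (auto simp: nbhd_def)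
    then show "y \<in> Q" using r(2)[of x y] that by force
  qed
  then show ?thesis using r(1) by blast
qed

text \<open>Again Janiszewski: neither \<open>T\<close> nor the closed complement of its
  neighbourhood separates the plane, and the two are disjoint.\<close>

lemma connected_nbhd_Diff_tree:
  assumes "is_tree T" "r > 0"
  shows "connected (nbhd T r - T)"
proof -
  have c: "connected (nbhd T r)"
    using assms by (intro connected_nbhd connected_tree tree_nonempty)
  have "T \<inter> - nbhd T r = {}" using subset_nbhd[OF assms(2), of T] by blast
  then have "connected (- (T \<union> - nbhd T r))"
    using c by (intro connected_Compl_Un compact_tree[OF assms(1)] connected_Compl_tree[OF assms(1)])
      (simp_all add: open_nbhd closed_Compl)
  moreover have "- (T \<union> - nbhd T r) = nbhd T r - T" by auto
  ultimately show ?thesis by simp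
qed

lemma convex_nbhd:
  fixes K :: "'a::real_normed_vector set"
  assumes "convex K"
  shows "convex (nbhd K r)"
proof -
  have "nbhd K r = (\<Union>x\<in>K. \<Union>y\<in>ball 0 r. {x + y})"
  proof (intro equalityI subsetI)
    fix z assume "z \<in> nbhd K r"
    then obtain x where "x \<in> K" "dist x z < r" by (auto simp: nbhd_def)
    then have "z - x \<in> ball 0 r" "z = x + (z - x)" by (auto simp: dist_norm norm_minus_commute)
    then show "z \<in> (\<Union>x\<in>K. \<Union>y\<in>ball 0 r. {x + y})" using \<open>x \<in> K\<close> by blast
  next
    fix z assume "z \<in> (\<Union>x\<in>K. \<Union>y\<in>ball 0 r. {x + y})"
    then obtain x y where "x \<in> K" "norm y < r" "z = x + y" by auto
    then have "z \<in> ball x r" by (simp add: dist_norm)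
    then show "z \<in> nbhd K r" using \<open>x \<in> K\<close> unfolding nbhd_def by blast
  qed
  then show ?thesis using convex_sums[OF assms convex_ball, of 0 r] by simp
qed

text \<open>Its projection is connected, hence an interval. So a boundary arc is a segment, and its
  collar in the square is an intersection of convex sets.\<close>

lemma arc_in_horizontal_line:
  assumes "is_arc S" "S \<subseteq> A \<times> {c}"
  shows "compact S" "convex S" "S \<noteq> {}"
proof -
  obtain g where g: "arc g" "path_image g = S" using assms(1) by (auto simp: is_arc_def)
  show "compact S" using g compact_arc_image by blast
  show "S \<noteq> {}" using g by auto
  have "connected S" using g arc_imp_path connected_path_image by blast
  then have "connected (fst ` S)" by (intro connected_continuous_image continuous_intros)
  then have "convex (fst ` S)" by (simp add: connected_convex_1)
  moreover have "S = fst ` S \<times> {c}" using assms(2) by force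
  ultimately show "convex S" by (metis convex_Times convex_singleton)
qed

text \<open>A countable dense subset is enumerated with every member recurring infinitely often:
  \<open>prod_decode\<close> yields the index of a member and a free counter.\<close>

lemma exists_recurrent_dense_sequence:
  fixes K :: "'a::euclidean_space set"
  assumes "K \<noteq> {}"
  shows "\<exists>\<tau> :: nat \<Rightarrow> 'a. (\<forall>k. \<tau> k \<in> K) \<and> (\<forall>y\<in>K. \<forall>e>0. \<forall>N. \<exists>k\<ge>N. dist (\<tau> k) y < e)"
proof -
  obtain D where D: "countable D" "D \<subseteq> K" "K \<subseteq> closure D" using separable by metis
  have "D \<noteq> {}" using D assms by auto
  define \<tau> where "\<tau> k = from_nat_into D (fst (prod_decode k))" for k
  have "\<tau> k \<in> K" for k using from_nat_into[OF \<open>D \<noteq> {}\<close>] D by (auto simp: \<tau>_def)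
  moreover have "\<exists>k\<ge>N. dist (\<tau> k) y < e" if y: "y \<in> K" "e > 0" for y e N
  proof -
    have "y \<in> closure D" using y D(3) by blast
    then obtain z where z: "z \<in> D" "dist z y < e" using y(2) unfolding closure_approachable by blast
    obtain n where "from_nat_into D n = z" using from_nat_into_surj[OF D(1) z(1)] by blast
    then have "dist (\<tau> (prod_encode (n, N))) y < e" using z by (simp add: \<tau>_def)
    then show ?thesis using le_prod_encode_2 by blast
  qed
  ultimately show ?thesis by blast
qed

lemma infdist_Compl_open_square_le:
  assumes "X \<subseteq> {-1<..<1} \<times> {-1<..<(1::real)}"
  shows "infdist (x :: real \<times> real) (- X) \<le> 1"
proof (cases "x \<in> X")
  case True
  obtain a b where x: "x = (a, b)" by (cases x)
  have "(a, 1) \<in> - X" "(a, -1) \<in> - X" using assms by auto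
  then have "infdist x (- X) \<le> dist x (a, 1)" "infdist x (- X) \<le> dist x (a, -1)"
    by (auto intro: infdist_le)
  moreover have "dist x (a, 1) = \<bar>b - 1\<bar>" "dist x (a, -1) = \<bar>b + 1\<bar>"
    by (simp_all add: x dist_Pair_Pair dist_real_def)
  ultimately show ?thesis using True assms x by auto
next
  case False
  then have "infdist x (- X) = 0" by (intro infdist_zero) auto
  then show ?thesis by simp
qed

text \<open>Points outside \<open>C\<close> are fixed, so by injectivity no point of
  \<open>C\<close> can be sent to one of them.\<close>

lemma closed_square_homeomorphism:
  assumes "homeomorphism UNIV UNIV \<psi> \<phi>" "\<And>x. x \<notin> X \<Longrightarrow> \<psi> x = x" "X \<subseteq> C"
  shows "homeomorphism C C \<psi> \<phi>"
proof -
  have inv: "\<phi> (\<psi> x) = x" "\<psi> (\<phi> x) = x" for x using assms(1) by (auto simp: homeomorphism_def)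
  have "\<psi> x \<in> C" if "x \<in> C" for x
  proof (rule ccontr)
    assume "\<psi> x \<notin> C"
    then have "\<psi> (\<psi> x) = \<psi> x" using assms(2,3) by blast
    then have "\<psi> x = x" using inv(1) by metis
    then show False using that \<open>\<psi> x \<notin> C\<close> by simp
  qed
  moreover have "\<phi> x \<in> C" if "x \<in> C" for x
  proof (rule ccontr)
    assume "\<phi> x \<notin> C"
    then have "\<psi> (\<phi> x) = \<phi> x" using assms(2,3) by blast
    then show False using that \<open>\<phi> x \<notin> C\<close> inv(2) by metis
  qed
  moreover have "continuous_on C \<psi>" "continuous_on C \<phi>"
    using assms(1) by (auto simp: homeomorphism_def intro: continuous_on_subset)
  ultimately show ?thesis using inv by (intro homeomorphismI) auto
qed

lemma infinite_dense_in_square: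
  assumes "{-1..1} \<times> {-1..(1::real)} \<subseteq> closure (W :: (real \<times> real) set)"
  shows "infinite W"
proof
  assume "finite W"
  then have "closure W = W" by (simp add: finite_imp_closed)
  then have "finite ({-1..1} \<times> {-1..(1::real)} :: (real \<times> real) set)"
    using assms \<open>finite W\<close> finite_subset by metis
  moreover have "infinite {-1..(1::real)}" by (simp add: infinite_Icc)
  ultimately show False by (simp add: finite_cartesian_product_iff)
qed

theorem theorem5p3:
  fixes m :: nat
    and T :: "nat \<Rightarrow> nat \<Rightarrow> (real \<times> real) set"
    and W :: "nat \<Rightarrow> (real \<times> real) set"
  assumes trees: "\<And>n i. n \<in> {1..m} \<Longrightarrow> i \<in> {1,2} \<Longrightarrow>
                     is_tree (T n i) \<and> T n i \<subseteq> {-1<..<1} \<times> {-1<..<1}"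
    and trees_disj: "\<And>n i n' i'. n \<in> {1..m} \<Longrightarrow> i \<in> {1,2} \<Longrightarrow> n' \<in> {1..m} \<Longrightarrow> i' \<in> {1,2}
                     \<Longrightarrow> (n, i) \<noteq> (n', i') \<Longrightarrow> T n i \<inter> T n' i' = {}"
    and T01: "is_arc (T 0 1)" "T 0 1 \<subseteq> {-1<..<1} \<times> {1}"
    and T02: "is_arc (T 0 2)" "T 0 2 \<subseteq> {-1<..<1} \<times> {-1}"
    and W_disj: "\<And>n n'. n \<in> {0..m} \<Longrightarrow> n' \<in> {0..m} \<Longrightarrow> n \<noteq> n' \<Longrightarrow> W n \<inter> W n' = {}"
    and W_count: "\<And>n. n \<in> {0..m} \<Longrightarrow> countable (W n)"
    and W_sub: "\<And>n. n \<in> {0..m} \<Longrightarrow>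
                  W n \<subseteq> ({-1<..<1} \<times> {-1<..<1}) - (\<Union>k\<in>{1..m}. T k 1 \<union> T k 2)"
    and W_dense: "\<And>n. n \<in> {0..m} \<Longrightarrow> {-1..1} \<times> {-1..1} \<subseteq> closure (W n)"
  shows "\<exists>\<psi> \<phi>. homeomorphism ({-1..1} \<times> {-1..1}) ({-1..1} \<times> {-1..1}) \<psi> \<phi> \<and>
           (\<forall>n\<in>{0..m}. \<forall>w\<in>W n. omega_limit \<psi> w = T n 1 \<and> omega_limit \<phi> w = T n 2)"
proof -
  define Q where "Q = {-1<..<(1::real)} \<times> {-1<..<(1::real)}"
  have Q: "open Q" "convex Q" "bounded Q"
    by (auto simp: Q_def open_Times convex_Times bounded_Times)
  define M where "M = {1..m} \<times> {1, 2::nat}"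
  define S where "S = (\<lambda>(n, i). T n i)"
  define X where "X = Q - (\<Union>j\<in>M. S j)"
  have M: "finite M" by (simp add: M_def)
  have S: "is_tree (S j)" "S j \<subseteq> Q" if "j \<in> M" for j
  proof -
    obtain n i where j: "j = (n, i)" "n \<in> {1..m}" "i \<in> {1, 2}" using \<open>j \<in> M\<close> unfolding M_def by blast
    show "is_tree (S j)" "S j \<subseteq> Q" using trees[OF j(2,3)] by (simp_all add: j(1) S_def Q_def)
  qed
  have Sdisj: "S i \<inter> S j = {}" if "i \<in> M" "j \<in> M" "i \<noteq> j" for i j
  proof -
    obtain n k n' k' where "i = (n, k)" "j = (n', k')" by fastforce
    then show ?thesis using that trees_disj[of n k n' k'] unfolding M_def S_def by auto
  qed
  have opens: "open (Q - (\<Union>j\<in>N. S j))" if "N \<subseteq> M" for N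
    using that finite_subset[OF that M] S(1)
    by (intro open_Diff closed_UN Q(1)) (auto intro!: compact_imp_closed compact_tree)
  have X: "open X" "connected X" "bounded X" "X \<subseteq> Q"
    unfolding X_def using opens connected_Diff_trees[OF M Q(1) convex_connected[OF Q(2)], of S] S Sdisj Q(3)
    by (auto intro: bounded_subset)
  define target where "target K \<longleftrightarrow> compact K \<and> K \<noteq> {} \<and> K \<inter> X = {} \<and> K \<subseteq> closure X
     \<and> (\<exists>r>0. \<forall>r'. 0 < r' \<longrightarrow> r' \<le> r \<longrightarrow> connected (nbhd K r' \<inter> X))" for K
  have target_tree: "target (S j)" if j: "j \<in> M" for j
  proof -
    \<comment> \<open>In \<open>O'\<close> the tree \<open>S j\<close> is alone: a collar lying in
      \<open>O'\<close> loses only \<open>S j\<close> when intersected with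
      \<open>X\<close>.\<close>
    define O' where "O' = Q - (\<Union>i\<in>M-{j}. S i)"
    have "open O'" unfolding O'_def by (rule opens) auto
    moreover have "S j \<subseteq> O'" using S(2)[OF j] Sdisj[OF j] by (fastforce simp: O'_def)
    ultimately obtain r where r: "r > 0" "\<And>r'. r' \<le> r \<Longrightarrow> nbhd (S j) r' \<subseteq> O'"
      using nbhd_subset_open[OF compact_tree[OF S(1)[OF j]]] by blast
    have XO: "X = O' - S j" using j by (auto simp: X_def O'_def)
    have eq: "nbhd (S j) r' \<inter> X = nbhd (S j) r' - S j" if "r' \<le> r" for r'
      using r(2)[OF that] XO by blast
    have "S j \<subseteq> closure X"
    proof
      fix y assume y: "y \<in> S j"
      have "\<exists>z\<in>X. dist z y < e" if "e > 0" for e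
      proof -
        have "\<not> ball y (min e r) \<subseteq> S j"
          using interior_tree[OF S(1)[OF j]] \<open>e > 0\<close> r(1) y mem_interior[of y "S j"] by (metis empty_iff min_less_iff_conj)
        then obtain z where z: "z \<in> ball y (min e r)" "z \<notin> S j" by blast
        then have "z \<in> nbhd (S j) r" using y by (auto simp: nbhd_def)
        then have "z \<in> X" using z eq[of r] by blast
        then show ?thesis using z by (auto simp: dist_commute)
      qed
      then show "y \<in> closure X" by (simp add: closure_approachable)
    qed
    moreover have "connected (nbhd (S j) r' \<inter> X)" if "0 < r'" "r' \<le> r" for r'
      using connected_nbhd_Diff_tree[OF S(1)[OF j]] that eq by simp
    ultimately show ?thesis
      using r(1) compact_tree[OF S(1)[OF j]] tree_nonempty[OF S(1)[OF j]] XO unfolding target_def by blast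
  qed
  have target_arc: "target A" if A: "is_arc A" "A \<subseteq> {-1<..<1} \<times> {c}" and c: "\<bar>c\<bar> = 1" for A c
  proof -
    note A' = arc_in_horizontal_line[OF A]
    \<comment> \<open>The square is left out of \<open>O'\<close>, since the arc lies on its border.
      A small collar avoids all trees, and its part in \<open>X\<close> is its intersection with the
      convex \<open>Q\<close>.\<close>
    define O' where "O' = - (\<Union>j\<in>M. S j)"
    have "open O'" unfolding O'_def using M S(1)
      by (intro open_Compl closed_UN) (auto intro!: compact_imp_closed compact_tree)
    moreover have AQ: "A \<inter> Q = {}"
    proof -
      have "snd x = c" if "x \<in> A" for x using A(2) that by auto
      moreover have "\<bar>snd x\<bar> < 1" if "x \<in> Q" for x using that by (auto simp: Q_def)
      ultimately show ?thesis using c by fastforce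
    qed
    then have "A \<subseteq> O'" using S(2) by (auto simp: O'_def)
    ultimately obtain r where r: "r > 0" "\<And>r'. r' \<le> r \<Longrightarrow> nbhd A r' \<subseteq> O'"
      using nbhd_subset_open[OF A'(1)] by blast
    have XO: "X = Q \<inter> O'" by (auto simp: X_def O'_def)
    have "connected (nbhd A r' \<inter> X)" if "0 < r'" "r' \<le> r" for r'
    proof -
      have "nbhd A r' \<inter> X = nbhd A r' \<inter> Q" using r(2)[OF that(2)] XO by blast
      then show ?thesis using convex_connected[OF convex_Int[OF convex_nbhd[OF A'(2)] Q(2)]] by simp
    qed
    moreover have "A \<subseteq> closure X"
    proof
      fix y assume y: "y \<in> A"
      then obtain a where a: "y = (a, c)" "-1 < a" "a < 1" using A(2) by auto
      have "\<exists>z\<in>X. dist z y < e" if "e > 0" for e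
      proof -
        define s where "s = min (min e r / 2) 1"
        have s: "0 < s" "s \<le> 1" "s < e" "s < r" using \<open>e > 0\<close> r(1) by (auto simp: s_def min_def)
        define z where "z = (a, c * (1 - s))"
        have "dist z y = \<bar>c * (1 - s) - c\<bar>" by (simp add: z_def a(1) dist_Pair_Pair dist_real_def)
        also have "c * (1 - s) - c = - (c * s)" by (simp add: algebra_simps)
        also have "\<bar>- (c * s)\<bar> = \<bar>c\<bar> * s" using s(1) by (simp add: abs_mult)
        finally have d: "dist z y = s" using c by simp
        have "\<bar>c * (1 - s)\<bar> < 1" using s c by (simp add: abs_mult)
        then have "z \<in> Q" using a by (auto simp: z_def Q_def)
        moreover have "z \<in> ball y r" using d s(4) by (simp add: dist_commute)
        then have "z \<in> nbhd A r" using y unfolding nbhd_def by blast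
        then have "z \<in> O'" using r(2)[of r] by blast
        ultimately have "z \<in> X" using XO by blast
        then show ?thesis using d s(3) by auto
      qed
      then show "y \<in> closure X" by (simp add: closure_approachable)
    qed
    moreover have "A \<inter> X = {}" using AQ XO by blast
    ultimately show ?thesis using r(1) A'(1,3) unfolding target_def by blast
  qed
  have target: "target (T n i)" if "n \<in> {0..m}" "i \<in> {1, 2}" for n i
  proof (cases "n = 0")
    case True
    then show ?thesis using that target_arc[OF T01] target_arc[OF T02] by auto
  next
    case False
    then have "(n, i) \<in> M" using that by (auto simp: M_def)
    then show ?thesis using target_tree[of "(n, i)"] by (simp add: S_def)
  qed
  define WW where "WW = (\<Union>n\<in>{0..m}. W n)"
  have "countable WW" using W_count by (auto simp: WW_def)
  moreover have "infinite WW"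
    using infinite_dense_in_square[OF W_dense[of 0]] infinite_super[of "W 0" WW] by (auto simp: WW_def)
  ultimately have bij: "bij_betw (from_nat_into WW) UNIV WW" by (rule bij_betw_from_nat_into)
  define w where "w = from_nat_into WW"
  have w: "inj w" "range w = WW" using bij by (auto simp: w_def bij_betw_def)
  have "\<exists>n. n \<in> {0..m} \<and> w i \<in> W n" for i using w(2) unfolding WW_def by blast
  then obtain lab where lab: "\<And>i. lab i \<in> {0..m}" "\<And>i. w i \<in> W (lab i)" by metis
  define K where "K j = T (lab (fst j)) (if snd j then 1 else 2)" for j
  have tK: "target (K j)" for j unfolding K_def by (rule target) (use lab in auto)
  have K: "compact (K j)" "K j \<noteq> {}" "K j \<inter> X = {}" "K j \<subseteq> closure X" for j
    using tK[of j] unfolding target_def by blast+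
  have "\<forall>j. \<exists>\<tau> :: nat \<Rightarrow> real \<times> real. (\<forall>k. \<tau> k \<in> K j) \<and> (\<forall>y\<in>K j. \<forall>e>0. \<forall>N. \<exists>k\<ge>N. dist (\<tau> k) y < e)"
    by (intro allI exists_recurrent_dense_sequence K(2))
  from choice[OF this] obtain \<tau> :: "nat \<times> bool \<Rightarrow> nat \<Rightarrow> real \<times> real"
    where "\<forall>j. (\<forall>k. \<tau> j k \<in> K j) \<and> (\<forall>y\<in>K j. \<forall>e>0. \<forall>N. \<exists>k\<ge>N. dist (\<tau> j k) y < e)" ..
  then have \<tau>: "\<And>j k. \<tau> j k \<in> K j"
      "\<And>j y e N. y \<in> K j \<Longrightarrow> e > 0 \<Longrightarrow> \<exists>k\<ge>N. dist (\<tau> j k) y < e" by blast+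
  define I where "I = {0..m} \<times> {1, 2::nat}"
  have "\<forall>p\<in>I. \<exists>r>0. \<forall>r'. 0 < r' \<longrightarrow> r' \<le> r \<longrightarrow> connected (nbhd (S p) r' \<inter> X)"
    using target unfolding target_def I_def S_def by auto
  from bchoice[OF this] obtain R
    where "\<forall>p\<in>I. R p > 0 \<and> (\<forall>r'. 0 < r' \<longrightarrow> r' \<le> R p \<longrightarrow> connected (nbhd (S p) r' \<inter> X))" ..
  then have R: "\<And>p. p \<in> I \<Longrightarrow> R p > 0"
      "\<And>p r'. p \<in> I \<Longrightarrow> 0 < r' \<Longrightarrow> r' \<le> R p \<Longrightarrow> connected (nbhd (S p) r' \<inter> X)" by blast+
  \<comment> \<open>There are infinitely many half orbits but only finitely many targets, so a
    common radius exists.\<close>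
  define \<rho>0 where "\<rho>0 = Min (R ` I)"
  note XQ = X(4) and range_w = w(2)
  have I: "finite I" "I \<noteq> {}" by (auto simp: I_def)
  interpret target_system X w K \<tau> \<rho>0
  proof
    show "infdist x (- X) \<le> 1" for x using X(4) unfolding Q_def by (rule infdist_Compl_open_square_le)
    show "w i \<in> X" for i
      using lab[of i] W_sub[of "lab i"] unfolding X_def Q_def M_def S_def by force
    show "0 < \<rho>0" using I R(1) by (simp add: \<rho>0_def)
    show "connected (nbhd (K j) \<rho> \<inter> X)" if "0 < \<rho>" "\<rho> \<le> \<rho>0" for j \<rho>
    proof -
      define p where "p = (lab (fst j), if snd j then 1 else 2::nat)"
      have "p \<in> I" using lab by (auto simp: p_def I_def)
      moreover have "\<rho>0 \<le> R p" unfolding \<rho>0_def using I \<open>p \<in> I\<close> by simp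
      ultimately show ?thesis using R(2)[of p \<rho>] that by (simp add: p_def S_def K_def)
    qed
    show "\<tau> j k \<in> closure X" for j k using \<tau>(1) K(4) by blast
  qed (use X w K \<tau> in auto)
  obtain \<psi> \<phi> where h: "homeomorphism UNIV UNIV \<psi> \<phi>" "\<And>x. x \<notin> X \<Longrightarrow> \<psi> x = x"
    and om: "\<And>i. omega_limit \<psi> (w i) = K (i, True)" "\<And>i. omega_limit \<phi> (w i) = K (i, False)"
    using exists_homeomorphism by blast
  have "X \<subseteq> {-1..1} \<times> {-1..1}" using XQ unfolding Q_def by auto
  then have "homeomorphism ({-1..1} \<times> {-1..1}) ({-1..1} \<times> {-1..1}) \<psi> \<phi>"
    using closed_square_homeomorphism[OF h] by blast
  moreover have "omega_limit \<psi> x = T n 1 \<and> omega_limit \<phi> x = T n 2" if n: "n \<in> {0..m}" and x: "x \<in> W n" for n x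
  proof -
    have "x \<in> range w" using n x range_w by (auto simp: WW_def)
    then obtain i where i: "x = w i" by blast
    then have "lab i = n" using W_disj[of "lab i" n] lab[of i] n x by blast
    then show ?thesis using om[of i] i by (simp add: K_def)
  qed
  ultimately show ?thesis by blast
qed

end
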